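(* Let $\Omega\subsetneq\mathbf{R}^d$ be a domain, let $\delta,\delta'\geq0$, set $c(s)=s^\delta(1+s)^{\delta'-\delta}$ for $s>0$, $c_\Omega=c\circ d_\Omega$, and $$\nu=\sup\{|1-t/2|^2:\ \delta\wedge\delta'\leq t\leq\delta\vee\delta'\}.$$ Let $h$ be the Dirichlet form on $L_2(\Omega)$ corresponding to $c$ and $H$ the associated submarkovian operator, as defined in the context. Assume that $h$ satisfies the Hardy inequality $$h(\varphi)\geq a_1\,(c_\Omega^{1/2}d_\Omega^{-1}\varphi,\,c_\Omega^{1/2}d_\Omega^{-1}\varphi)$$ for all $\varphi\in D(h)$, with $a_1>0$. If $\nu<a_1$ then $H$ satisfies the Rellich inequality $$(H\varphi,H\varphi)\geq a_2\,(c_\Omega d_\Omega^{-2}\varphi,\,c_\Omega d_\Omega^{-2}\varphi)$$ for all $\varphi\in D(H)$, with $a_2=(a_1-\nu)^2$ (in particular $c_\Omega d_\Omega^{-2}\varphi\in L_2(\Omega)$ for all $\varphi\in D(H)$).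
   Context: A domain is a connected open subset of $\mathbf{R}^d$. $d_\Omega(x)=\inf_{y\in\Omega^c}|x-y|$ is the Euclidean distance from $x\in\Omega$ to the boundary. $L_2(\Omega)$ is the real $L_2$-space with respect to Lebesgue measure, with inner product $(\cdot,\cdot)$. The form $h$ is the closure of $$\varphi\in C_c^\infty(\Omega)\mapsto h(\varphi)=\sum_{k=1}^d(\partial_k\varphi,c_\Omega\,\partial_k\varphi),$$ which is closable; its closure is a local Dirichlet form with domain $D(h)$. $H$ is the positive self-adjoint operator associated with $h$ ($D(h)=D(H^{1/2})$, $h(\varphi)=\|H^{1/2}\varphi\|_2^2$), i.e. the operator $-\sum_k\partial_k c_\Omega\partial_k$ with Dirichlet boundary conditions. $\wedge$ and $\vee$ denote minimum and maximum. That the Hardy inequality holds for $\varphi\in D(h)$ includes the statement that $c_\Omega^{1/2}d_\Omega^{-1}\varphi\in L_2(\Omega)$. *)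

theory Defs
  imports "HOL-Analysis.Analysis"
begin

section \<open>The real space \<open>L\<^sub>2(\<Omega>)\<close>\<close>

text \<open>Elements of \<open>L\<^sub>2(\<Omega>)\<close> are represented by total functions; values outside \<open>\<Omega>\<close> are
  irrelevant, and all notions below are invariant under changes on a Lebesgue null set.\<close>

definition L2 :: "'a::euclidean_space set \<Rightarrow> ('a \<Rightarrow> real) set" where
  "L2 \<Omega> = {f. f \<in> borel_measurable (lebesgue_on \<Omega>) \<and> integrable (lebesgue_on \<Omega>) (\<lambda>x. (f x)\<^sup>2)}"

definition L2_inner :: "'a::euclidean_space set \<Rightarrow> ('a \<Rightarrow> real) \<Rightarrow> ('a \<Rightarrow> real) \<Rightarrow> real" where
  "L2_inner \<Omega> f g = (LINT x|lebesgue_on \<Omega>. f x * g x)"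

section \<open>Test functions\<close>

definition partial :: "'a::euclidean_space \<Rightarrow> ('a \<Rightarrow> real) \<Rightarrow> 'a \<Rightarrow> real" where
  "partial k f x = frechet_derivative f (at x) k"

fun times_cont_diff :: "nat \<Rightarrow> ('a::euclidean_space \<Rightarrow> real) \<Rightarrow> bool" where
  "times_cont_diff 0 f \<longleftrightarrow> continuous_on UNIV f"
| "times_cont_diff (Suc n) f \<longleftrightarrow>
     (\<forall>x. f differentiable (at x)) \<and> (\<forall>k\<in>Basis. times_cont_diff n (partial k f))"

text \<open>\<open>C\<^sub>c\<^sup>\<infinity>(\<Omega>)\<close>, its elements being extended by zero to the whole space.\<close>

definition test_functions :: "'a::euclidean_space set \<Rightarrow> ('a \<Rightarrow> real) set" where
  "test_functions \<Omega> = {\<phi>. (\<forall>n. times_cont_diff n \<phi>) \<and>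
     compact (closure {x. \<phi> x \<noteq> 0}) \<and> closure {x. \<phi> x \<noteq> 0} \<subseteq> \<Omega>}"

section \<open>Closure of a quadratic form\<close>

text \<open>A quadratic form on \<open>L\<^sub>2(\<Omega>)\<close> is given by its domain \<open>D\<close> and its values \<open>q \<phi>\<close>. A sequence
  in \<open>D\<close> approximates \<open>\<phi>\<close> if it converges to \<open>\<phi>\<close> in \<open>L\<^sub>2(\<Omega>)\<close> and is Cauchy for \<open>q\<close>.\<close>

definition form_approx ::
  "'a::euclidean_space set \<Rightarrow> ('a \<Rightarrow> real) set \<Rightarrow> (('a \<Rightarrow> real) \<Rightarrow> real) \<Rightarrow>
   ('a \<Rightarrow> real) \<Rightarrow> (nat \<Rightarrow> 'a \<Rightarrow> real) \<Rightarrow> bool" where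
  "form_approx \<Omega> D q \<phi> u \<longleftrightarrow>
     (\<forall>n. u n \<in> D) \<and>
     (\<lambda>n. L2_inner \<Omega> (\<lambda>x. u n x - \<phi> x) (\<lambda>x. u n x - \<phi> x)) \<longlonglongrightarrow> 0 \<and>
     (\<forall>e>0. \<exists>N. \<forall>m\<ge>N. \<forall>n\<ge>N. q (\<lambda>x. u m x - u n x) < e)"

definition closure_dom ::
  "'a::euclidean_space set \<Rightarrow> ('a \<Rightarrow> real) set \<Rightarrow> (('a \<Rightarrow> real) \<Rightarrow> real) \<Rightarrow> ('a \<Rightarrow> real) set" where
  "closure_dom \<Omega> D q = {\<phi> \<in> L2 \<Omega>. \<exists>u. form_approx \<Omega> D q \<phi> u}"

text \<open>For a closable form the limit below does not depend on the approximating sequence.\<close>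

definition closure_form ::
  "'a::euclidean_space set \<Rightarrow> ('a \<Rightarrow> real) set \<Rightarrow> (('a \<Rightarrow> real) \<Rightarrow> real) \<Rightarrow> ('a \<Rightarrow> real) \<Rightarrow> real" where
  "closure_form \<Omega> D q \<phi> = (THE l. \<exists>u. form_approx \<Omega> D q \<phi> u \<and> (\<lambda>n. q (u n)) \<longlonglongrightarrow> l)"

section \<open>The operator associated with a form\<close>

definition polarization :: "(('a \<Rightarrow> real) \<Rightarrow> real) \<Rightarrow> ('a \<Rightarrow> real) \<Rightarrow> ('a \<Rightarrow> real) \<Rightarrow> real" where
  "polarization q f g = (q (\<lambda>x. f x + g x) - q (\<lambda>x. f x - g x)) / 4"

text \<open>The graph of the operator: \<open>(\<phi>, \<psi>)\<close> belongs to it iff \<open>\<phi>\<close> is in the operator domain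
  and \<open>\<psi>\<close> represents the image of \<open>\<phi>\<close>. The domain of the operator is the \<open>Domain\<close> of the graph.\<close>

definition form_operator ::
  "'a::euclidean_space set \<Rightarrow> ('a \<Rightarrow> real) set \<Rightarrow> (('a \<Rightarrow> real) \<Rightarrow> real) \<Rightarrow>
   (('a \<Rightarrow> real) \<times> ('a \<Rightarrow> real)) set" where
  "form_operator \<Omega> D q = {(\<phi>, \<psi>). \<phi> \<in> D \<and> \<psi> \<in> L2 \<Omega> \<and>
     (\<forall>\<eta>\<in>D. polarization q \<phi> \<eta> = L2_inner \<Omega> \<psi> \<eta>)}"

definition L2_adjoint ::
  "'a::euclidean_space set \<Rightarrow> (('a \<Rightarrow> real) \<times> ('a \<Rightarrow> real)) set \<Rightarrow>
   (('a \<Rightarrow> real) \<times> ('a \<Rightarrow> real)) set" where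
  "L2_adjoint \<Omega> S = {(f, g). f \<in> L2 \<Omega> \<and> g \<in> L2 \<Omega> \<and>
     (\<forall>(u, v)\<in>S. L2_inner \<Omega> v f = L2_inner \<Omega> u g)}"

lemma L2_integrable_mult:
  assumes "f \<in> L2 \<Omega>" "g \<in> L2 \<Omega>"
  shows "integrable (lebesgue_on \<Omega>) (\<lambda>x. f x * g x)"
proof (rule Bochner_Integration.integrable_bound)
  show "integrable (lebesgue_on \<Omega>) (\<lambda>x. (f x)\<^sup>2 + (g x)\<^sup>2)"
    using assms by (auto simp: L2_def)
  show "(\<lambda>x. f x * g x) \<in> borel_measurable (lebesgue_on \<Omega>)"
    using assms by (auto simp: L2_def)
  have "\<bar>a * b\<bar> \<le> a\<^sup>2 + b\<^sup>2" for a b :: real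
  proof -
    have "2 * (\<bar>a\<bar> * \<bar>b\<bar>) \<le> a\<^sup>2 + b\<^sup>2"
      using sum_squares_bound[of "\<bar>a\<bar>" "\<bar>b\<bar>"] by (simp add: mult.assoc)
    moreover have "0 \<le> \<bar>a\<bar> * \<bar>b\<bar>" by simp
    ultimately show ?thesis unfolding abs_mult by linarith
  qed
  then show "AE x in lebesgue_on \<Omega>. norm (f x * g x) \<le> norm ((f x)\<^sup>2 + (g x)\<^sup>2)"
    by simp
qed

lemma L2_add_diff:
  assumes "f \<in> L2 \<Omega>" "g \<in> L2 \<Omega>"
  shows "(\<lambda>x. f x + g x) \<in> L2 \<Omega>" and "(\<lambda>x. f x - g x) \<in> L2 \<Omega>"
  using assms L2_integrable_mult[OF assms]
  by (auto simp: L2_def power2_sum power2_diff mult.assoc)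

lemma L2_inner_add_diff:
  assumes "f \<in> L2 \<Omega>" "g \<in> L2 \<Omega>" "h \<in> L2 \<Omega>"
  shows "L2_inner \<Omega> h (\<lambda>x. f x + g x) = L2_inner \<Omega> h f + L2_inner \<Omega> h g"
    and "L2_inner \<Omega> h (\<lambda>x. f x - g x) = L2_inner \<Omega> h f - L2_inner \<Omega> h g"
  using L2_integrable_mult[OF assms(3,1)] L2_integrable_mult[OF assms(3,2)]
  by (simp_all add: L2_inner_def distrib_left right_diff_distrib)

lemma L2_inner_commute: "L2_inner \<Omega> f g = L2_inner \<Omega> g f"
  by (simp add: L2_inner_def mult.commute)

text \<open>If \<open>S\<close> is self-adjoint with domain \<open>D\<close> and \<open>q \<phi> = \<parallel>S \<phi>\<parallel>\<^sup>2\<close>, then the operator associated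
  with \<open>q\<close> is \<open>S \<circ> S\<close>. Taking the positive such \<open>S\<close>, the associated operator is the \<open>H\<close>
  determined by \<open>D = D(H\<^sup>1\<^sup>/\<^sup>2)\<close> and \<open>q \<phi> = \<parallel>H\<^sup>1\<^sup>/\<^sup>2 \<phi>\<parallel>\<^sup>2\<close>.\<close>

lemma form_operator_eq_square:
  assumes sa: "S = L2_adjoint \<Omega> S"
    and dom: "Domain S = D"
    and q: "\<And>\<phi> \<psi>. (\<phi>, \<psi>) \<in> S \<Longrightarrow> q \<phi> = L2_inner \<Omega> \<psi> \<psi>"
  shows "form_operator \<Omega> D q = S O S"
proof -
  have L: "f \<in> L2 \<Omega>" "g \<in> L2 \<Omega>" if "(f, g) \<in> S" for f g
    using that by (subst (asm) sa, simp add: L2_adjoint_def)+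
  have sym: "L2_inner \<Omega> v f = L2_inner \<Omega> u g" if "(f, g) \<in> S" "(u, v) \<in> S" for f g u v
    using that(1) by (subst (asm) sa) (use that(2) in \<open>auto simp: L2_adjoint_def\<close>)
  have mem: "(f, g) \<in> S" if "f \<in> L2 \<Omega>" "g \<in> L2 \<Omega>"
      "\<And>u v. (u, v) \<in> S \<Longrightarrow> L2_inner \<Omega> v f = L2_inner \<Omega> u g" for f g
    by (subst sa) (use that in \<open>auto simp: L2_adjoint_def\<close>)
  have pol: "polarization q f u = L2_inner \<Omega> g v" if S: "(f, g) \<in> S" "(u, v) \<in> S" for f g u v
  proof -
    note l = L[OF S(1)] L[OF S(2)]
    have "((\<lambda>x. f x + u x), (\<lambda>x. g x + v x)) \<in> S"
      by (rule mem) (use l L sym S in \<open>auto simp: L2_add_diff L2_inner_add_diff\<close>)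
    moreover have "((\<lambda>x. f x - u x), (\<lambda>x. g x - v x)) \<in> S"
      by (rule mem) (use l L sym S in \<open>auto simp: L2_add_diff L2_inner_add_diff\<close>)
    ultimately have "polarization q f u =
        (L2_inner \<Omega> (\<lambda>x. g x + v x) (\<lambda>x. g x + v x) - L2_inner \<Omega> (\<lambda>x. g x - v x) (\<lambda>x. g x - v x)) / 4"
      by (simp add: polarization_def q)
    also have "\<dots> = L2_inner \<Omega> g v"
    proof -
      have 1: "L2_inner \<Omega> (\<lambda>x. g x + v x) w = L2_inner \<Omega> g w + L2_inner \<Omega> v w"
        and 2: "L2_inner \<Omega> (\<lambda>x. g x - v x) w = L2_inner \<Omega> g w - L2_inner \<Omega> v w"
        if "w \<in> L2 \<Omega>" for w
        unfolding L2_inner_commute[of \<Omega> _ w] using L2_inner_add_diff[of g \<Omega> v w] l that by auto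
      show ?thesis
        using l L2_inner_commute[of \<Omega> v g]
        by (simp add: 1 2 L2_add_diff L2_inner_add_diff)
    qed
    finally show ?thesis .
  qed
  show ?thesis
  proof (intro set_eqI iffI; clarify)
    fix f h assume "(f, h) \<in> form_operator \<Omega> D q"
    then have f: "f \<in> D" and h: "h \<in> L2 \<Omega>"
      and eq: "\<And>u. u \<in> D \<Longrightarrow> polarization q f u = L2_inner \<Omega> h u"
      by (auto simp: form_operator_def)
    obtain g where g: "(f, g) \<in> S" using f dom by blast
    have "(g, h) \<in> S"
    proof (rule mem)
      fix u v assume uv: "(u, v) \<in> S"
      then have "u \<in> D" using dom by blast
      then show "L2_inner \<Omega> v g = L2_inner \<Omega> u h"
        using eq[of u] pol[OF g uv] by (simp add: L2_inner_commute)
    qed (use L[OF g] h in auto)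
    then show "(f, h) \<in> S O S" using g by blast
  next
    fix f g h assume fg: "(f, g) \<in> S" and gh: "(g, h) \<in> S"
    have "polarization q f u = L2_inner \<Omega> h u" if uD: "u \<in> D" for u
    proof -
      obtain v where uv: "(u, v) \<in> S" using uD dom by blast
      show ?thesis using pol[OF fg uv] sym[OF gh uv] by (simp add: L2_inner_commute)
    qed
    then show "(f, h) \<in> form_operator \<Omega> D q"
      using fg L[OF gh] dom by (auto simp: form_operator_def)
  qed
qed

section \<open>The degenerate elliptic operator on \<open>\<Omega>\<close>\<close>

definition bdist :: "'a::euclidean_space set \<Rightarrow> 'a \<Rightarrow> real" where
  "bdist \<Omega> x = infdist x (- \<Omega>)"

definition coef :: "real \<Rightarrow> real \<Rightarrow> real \<Rightarrow> real" where
  "coef \<delta> \<delta>' s = s powr \<delta> * (1 + s) powr (\<delta>' - \<delta>)"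

definition coef_on :: "real \<Rightarrow> real \<Rightarrow> 'a::euclidean_space set \<Rightarrow> 'a \<Rightarrow> real" where
  "coef_on \<delta> \<delta>' \<Omega> = coef \<delta> \<delta>' \<circ> bdist \<Omega>"

definition pre_form :: "real \<Rightarrow> real \<Rightarrow> 'a::euclidean_space set \<Rightarrow> ('a \<Rightarrow> real) \<Rightarrow> real" where
  "pre_form \<delta> \<delta>' \<Omega> \<phi> =
     (\<Sum>k\<in>Basis. L2_inner \<Omega> (partial k \<phi>) (\<lambda>x. coef_on \<delta> \<delta>' \<Omega> x * partial k \<phi> x))"

definition h_dom :: "real \<Rightarrow> real \<Rightarrow> 'a::euclidean_space set \<Rightarrow> ('a \<Rightarrow> real) set" where
  "h_dom \<delta> \<delta>' \<Omega> = closure_dom \<Omega> (test_functions \<Omega>) (pre_form \<delta> \<delta>' \<Omega>)"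

definition h_form :: "real \<Rightarrow> real \<Rightarrow> 'a::euclidean_space set \<Rightarrow> ('a \<Rightarrow> real) \<Rightarrow> real" where
  "h_form \<delta> \<delta>' \<Omega> = closure_form \<Omega> (test_functions \<Omega>) (pre_form \<delta> \<delta>' \<Omega>)"

definition H_op ::
  "real \<Rightarrow> real \<Rightarrow> 'a::euclidean_space set \<Rightarrow> (('a \<Rightarrow> real) \<times> ('a \<Rightarrow> real)) set" where
  "H_op \<delta> \<delta>' \<Omega> = form_operator \<Omega> (h_dom \<delta> \<delta>' \<Omega>) (h_form \<delta> \<delta>' \<Omega>)"

definition nu :: "real \<Rightarrow> real \<Rightarrow> real" where
  "nu \<delta> \<delta>' = (SUP t\<in>{min \<delta> \<delta>'..max \<delta> \<delta>'}. \<bar>1 - t / 2\<bar>\<^sup>2)"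

end

theory Submission
  imports Defs
begin

text \<open>With \<open>\<chi> = c\<^sub>\<Omega>\<^sup>1\<^sup>/\<^sup>2 / d\<^sub>\<Omega>\<close> one has formally
  \<open>(H\<phi>, \<chi>\<^sup>2\<phi>) = h(\<chi>\<phi>) - \<integral> c\<^sub>\<Omega> \<bar>\<nabla>\<chi>\<bar>\<^sup>2 \<phi>\<^sup>2\<close>. The Hardy inequality gives \<open>h(\<chi>\<phi>) \<ge> a\<^sub>1 \<parallel>\<chi>\<^sup>2\<phi>\<parallel>\<^sup>2\<close>,
  the logarithmic derivative of \<open>c(s)\<^sup>1\<^sup>/\<^sup>2 / s\<close> gives \<open>c\<^sub>\<Omega> \<bar>\<nabla>\<chi>\<bar>\<^sup>2 \<le> \<nu> \<chi>\<^sup>4\<close>, and the Cauchy--Schwarz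
  inequality concludes. To make this rigorous, \<open>\<chi>\<close> is replaced by the bounded functions
  \<open>(\<chi>\<^sup>-\<^sup>2 + e)\<^sup>-\<^sup>1\<^sup>/\<^sup>2\<close>, which satisfy the same gradient bound, with a final monotone limit \<open>e \<rightarrow> 0\<close>.
  The distance \<open>d\<^sub>\<Omega>\<close> is only Lipschitz; on the support of a test function it is replaced by
  \<open>(\<Sum>y\<in>Y. \<bar>x - y\<bar>\<^sup>-\<^sup>p)\<^sup>-\<^sup>1\<^sup>/\<^sup>p\<close> with a finite set \<open>Y\<close> outside \<open>\<Omega>\<close> and large \<open>p\<close>, which is smooth on \<open>\<Omega>\<close>
  with gradient at most \<open>1\<close>.\<close>

section \<open>Semi-inner products\<close>

text \<open>The form domain is known only as a closure of test functions, so no Leibniz rule is at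
  hand inside it: a product is formed only from a test function and a weight smooth on \<Omega>, and
  the limit is taken afterwards. The smooth weights converge uniformly on the supports, but their
  gradients are merely bounded, so the products converge in L2 with bounded energy and need not be
  Cauchy for the form. Two facts replace strong convergence: an L2 limit with bounded energies lies
  in the domain, with energy at most the limiting bound, and \<open>B (u n) (v n)\<close> converges
  when \<open>u\<close> is Cauchy for the form and \<open>v\<close> only bounded. This suffices
  because Hardy bounds the energy of \<chi>\<phi> from below, so the product identity has to supply
  only an upper bound. The constant \<nu> arises because s times the logarithmic derivative of
  s^2/c(s) is 2 - t, where t = \<delta> + (\<delta>' - \<delta>) s/(1 + s) lies between \<delta> and
  \<delta>'; passing to the power -1/2 turns this into -(1 - t/2). Bounded weights also make the
  norm of \<chi>^2 \<phi> finite before Cauchy--Schwarz cancels it.\<close>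

locale semi_inner =
  fixes V :: "('a \<Rightarrow> real) set" and B :: "('a \<Rightarrow> real) \<Rightarrow> ('a \<Rightarrow> real) \<Rightarrow> real"
  assumes lincomb: "f \<in> V \<Longrightarrow> g \<in> V \<Longrightarrow> (\<lambda>x. a * f x + b * g x) \<in> V"
    and B_lincomb: "f \<in> V \<Longrightarrow> g \<in> V \<Longrightarrow> h \<in> V \<Longrightarrow>
      B (\<lambda>x. a * f x + b * g x) h = a * B f h + b * B g h"
    and B_sym: "f \<in> V \<Longrightarrow> g \<in> V \<Longrightarrow> B f g = B g f"
    and B_nonneg: "f \<in> V \<Longrightarrow> 0 \<le> B f f"
begin

lemma add_mem: "f \<in> V \<Longrightarrow> g \<in> V \<Longrightarrow> (\<lambda>x. f x + g x) \<in> V"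
  using lincomb[of f g 1 1] by simp

lemma diff_mem: "f \<in> V \<Longrightarrow> g \<in> V \<Longrightarrow> (\<lambda>x. f x - g x) \<in> V"
  using lincomb[of f g 1 "-1"] by simp

lemma B_lincomb_right:
  assumes "f \<in> V" "g \<in> V" "h \<in> V"
  shows "B h (\<lambda>x. a * f x + b * g x) = a * B h f + b * B h g"
  using assms by (simp add: B_sym[of h] lincomb B_lincomb)

lemma B_diff: "f \<in> V \<Longrightarrow> g \<in> V \<Longrightarrow> h \<in> V \<Longrightarrow> B (\<lambda>x. f x - g x) h = B f h - B g h"
  using B_lincomb[of f g h 1 "-1"] by simp

lemma B_diff_right: "f \<in> V \<Longrightarrow> g \<in> V \<Longrightarrow> h \<in> V \<Longrightarrow> B h (\<lambda>x. f x - g x) = B h f - B h g"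
  using B_lincomb_right[of f g h 1 "-1"] by simp

lemma B_square_lincomb:
  assumes "f \<in> V" "g \<in> V"
  shows "B (\<lambda>x. a * f x + b * g x) (\<lambda>x. a * f x + b * g x)
    = a\<^sup>2 * B f f + 2 * a * b * B f g + b\<^sup>2 * B g g"
  using assms B_sym[of f g]
  by (simp add: lincomb B_lincomb B_lincomb_right power2_eq_square algebra_simps)

lemma Cauchy_Schwarz:
  assumes f: "f \<in> V" and g: "g \<in> V"
  shows "(B f g)\<^sup>2 \<le> B f f * B g g"
proof -
  have *: "(B u v)\<^sup>2 \<le> B u u * B v v" if "u \<in> V" "v \<in> V" "B v v > 0" for u v
  proof -
    \<comment> \<open>Nonnegativity of \<open>B\<close> at \<open>B v v\<close> times
      \<open>u\<close> minus \<open>B u v\<close> times \<open>v\<close>, the rescaled component of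
      \<open>u\<close> orthogonal to \<open>v\<close>.\<close>
    have "0 \<le> B v v * (B u u * B v v - (B u v)\<^sup>2)"
      using B_nonneg[OF lincomb[OF that(1,2), of "B v v" "- B u v"]]
        B_square_lincomb[OF that(1,2), of "B v v" "- B u v"]
      by (simp add: power2_eq_square algebra_simps)
    then show ?thesis using that(3) by (simp add: zero_le_mult_iff)
  qed
  consider "B g g > 0" | "B f f > 0" | "B f f = 0" "B g g = 0"
    using B_nonneg[OF f] B_nonneg[OF g] by linarith
  then show ?thesis
  proof cases
    case 1 then show ?thesis using * f g by blast
  next
    case 2 then show ?thesis using *[of g f] f g B_sym[OF f g] by (simp add: mult.commute)
  next
    \<comment> \<open>With both squared norms zero, nonnegativity at \<open>f + g\<close> and at
      \<open>f - g\<close> forces \<open>B f g = 0\<close>.\<close>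
    case 3
    then show ?thesis
      using B_nonneg[OF lincomb[OF f g, of 1 1]] B_nonneg[OF lincomb[OF f g, of 1 "-1"]]
        B_square_lincomb[OF f g, of 1 1] B_square_lincomb[OF f g, of 1 "-1"]
      by simp
  qed
qed

definition nrm :: "('a \<Rightarrow> real) \<Rightarrow> real" where "nrm f = sqrt (B f f)"

lemma nrm_nonneg: "f \<in> V \<Longrightarrow> 0 \<le> nrm f"
  by (simp add: nrm_def B_nonneg)

lemma nrm_square: "f \<in> V \<Longrightarrow> (nrm f)\<^sup>2 = B f f"
  by (simp add: nrm_def B_nonneg)

lemma abs_B_le: "f \<in> V \<Longrightarrow> g \<in> V \<Longrightarrow> \<bar>B f g\<bar> \<le> nrm f * nrm g"
  using real_sqrt_le_mono[OF Cauchy_Schwarz] by (simp add: nrm_def real_sqrt_mult)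

lemma nrm_add:
  assumes f: "f \<in> V" and g: "g \<in> V"
  shows "nrm (\<lambda>x. f x + g x) \<le> nrm f + nrm g"
proof (rule power2_le_imp_le)
  have "(nrm (\<lambda>x. f x + g x))\<^sup>2 = B f f + 2 * B f g + B g g"
    using B_square_lincomb[OF f g, of 1 1] nrm_square[OF add_mem[OF f g]] by simp
  also have "\<dots> \<le> (nrm f + nrm g)\<^sup>2"
    using abs_B_le[OF f g] nrm_square[OF f] nrm_square[OF g] by (simp add: power2_sum)
  finally show "(nrm (\<lambda>x. f x + g x))\<^sup>2 \<le> (nrm f + nrm g)\<^sup>2" .
qed (simp add: nrm_nonneg f g)

lemma nrm_diff_commute:
  assumes f: "f \<in> V" and g: "g \<in> V"
  shows "nrm (\<lambda>x. f x - g x) = nrm (\<lambda>x. g x - f x)"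
  using B_square_lincomb[OF f g, of 1 "-1"] B_square_lincomb[OF f g, of "-1" 1]
  by (simp add: nrm_def)

lemma nrm_diff: "f \<in> V \<Longrightarrow> g \<in> V \<Longrightarrow> nrm (\<lambda>x. f x - g x) \<le> nrm f + nrm g"
  using B_square_lincomb[of f g 0 "-1"] nrm_add[of f "\<lambda>x. 0 * f x + (-1) * g x"] lincomb[of f g 0 "-1"]
  by (simp add: nrm_def)

lemma abs_nrm_diff:
  assumes "f \<in> V" "g \<in> V" shows "\<bar>nrm f - nrm g\<bar> \<le> nrm (\<lambda>x. f x - g x)"
  using nrm_add[of g "\<lambda>x. f x - g x"] nrm_add[of f "\<lambda>x. g x - f x"] assms
  by (simp add: diff_mem nrm_diff_commute[of g f])

text \<open>Parallelogram identity with a midpoint. It serves twice: as midpoint convexity of the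
  squared norm, and to force two near-minimizers to be close.\<close>

lemma B_midpoint:
  assumes f: "f \<in> V" and g: "g \<in> V"
  shows "4 * B (\<lambda>x. (f x + g x) / 2) (\<lambda>x. (f x + g x) / 2) + B (\<lambda>x. f x - g x) (\<lambda>x. f x - g x)
    = 2 * B f f + 2 * B g g"
  using B_square_lincomb[OF f g, of "1/2" "1/2"] B_square_lincomb[OF f g, of 1 "-1"]
  by (simp add: add_divide_distrib power2_eq_square)

lemma midpoint_mem: "f \<in> V \<Longrightarrow> g \<in> V \<Longrightarrow> (\<lambda>x. (f x + g x) / 2) \<in> V"
  using lincomb[of f g "1/2" "1/2"] by (simp add: add_divide_distrib)

text \<open>Squared norms are used so that, for the L2 inner product, this is literally the
  convergence clause of \<open>form_approx\<close>.\<close>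

definition conv :: "(nat \<Rightarrow> 'a \<Rightarrow> real) \<Rightarrow> ('a \<Rightarrow> real) \<Rightarrow> bool" where
  "conv u \<phi> \<longleftrightarrow> (\<lambda>n. B (\<lambda>x. u n x - \<phi> x) (\<lambda>x. u n x - \<phi> x)) \<longlonglongrightarrow> 0"

lemma conv_iff_nrm:
  assumes "\<And>n. u n \<in> V" "\<phi> \<in> V"
  shows "conv u \<phi> \<longleftrightarrow> (\<lambda>n. nrm (\<lambda>x. u n x - \<phi> x)) \<longlonglongrightarrow> 0"
proof
  show "conv u \<phi> \<Longrightarrow> (\<lambda>n. nrm (\<lambda>x. u n x - \<phi> x)) \<longlonglongrightarrow> 0"
    using tendsto_real_sqrt[of _ 0] unfolding conv_def nrm_def by fastforce
  show "(\<lambda>n. nrm (\<lambda>x. u n x - \<phi> x)) \<longlonglongrightarrow> 0 \<Longrightarrow> conv u \<phi>"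
    using tendsto_power[of _ 0 sequentially 2] assms
    unfolding conv_def by (fastforce simp: nrm_square diff_mem)
qed

lemma conv_lincomb:
  assumes uV: "\<And>n. u n \<in> V" and pV: "\<phi> \<in> V" and yV: "\<And>n. y n \<in> V" and eV: "\<eta> \<in> V"
    and u: "conv u \<phi>" and y: "conv y \<eta>"
  shows "conv (\<lambda>n x. a * u n x + b * y n x) (\<lambda>x. a * \<phi> x + b * \<eta> x)"
proof -
  let ?U = "\<lambda>n x. u n x - \<phi> x" and ?Y = "\<lambda>n x. y n x - \<eta> x"
  have UV: "?U n \<in> V" "?Y n \<in> V" for n by (simp_all add: diff_mem uV pV yV eV)
  have eq: "(\<lambda>x. a * u n x + b * y n x - (a * \<phi> x + b * \<eta> x)) = (\<lambda>x. a * ?U n x + b * ?Y n x)" for n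
    by (auto simp: algebra_simps)
  have "(\<lambda>n. nrm (?U n) * nrm (?Y n)) \<longlonglongrightarrow> 0 * 0"
    using u y by (intro tendsto_mult) (simp_all add: conv_iff_nrm uV pV yV eV)
  then have "(\<lambda>n. nrm (?U n) * nrm (?Y n)) \<longlonglongrightarrow> 0" by simp
  then have UY: "(\<lambda>n. B (?U n) (?Y n)) \<longlonglongrightarrow> 0"
    by (rule Lim_null_comparison[rotated]) (simp add: abs_B_le UV)
  have "(\<lambda>n. a\<^sup>2 * B (?U n) (?U n) + 2 * a * b * B (?U n) (?Y n) + b\<^sup>2 * B (?Y n) (?Y n))
      \<longlonglongrightarrow> a\<^sup>2 * 0 + 2 * a * b * 0 + b\<^sup>2 * 0"
    using u y UY unfolding conv_def by (intro tendsto_intros)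
  then show ?thesis
    unfolding conv_def eq by (simp only: B_square_lincomb UV) simp
qed

lemma nrm_bounded:
  fixes N :: nat
  assumes uV: "\<And>n. u n \<in> V" and "\<And>m n. m \<ge> N \<Longrightarrow> n \<ge> N \<Longrightarrow> B (\<lambda>x. u m x - u n x) (\<lambda>x. u m x - u n x) < 1"
  shows "\<exists>M\<ge>0. \<forall>n. nrm (u n) \<le> M"
proof -
  let ?M = "(\<Sum>i\<le>N. nrm (u i)) + 1"
  have N: "nrm (u N) \<le> (\<Sum>i\<le>N. nrm (u i))"
    by (rule member_le_sum) (auto simp: nrm_nonneg uV)
  have "nrm (u n) \<le> ?M" for n
  proof (cases "n \<le> N")
    case True
    have "nrm (u n) \<le> (\<Sum>i\<le>N. nrm (u i))"
      by (rule member_le_sum) (use True in \<open>auto simp: nrm_nonneg uV\<close>)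
    then show ?thesis by simp
  next
    case False
    then have "nrm (\<lambda>x. u n x - u N x) < 1"
      using assms(2)[of n N] by (simp add: nrm_def)
    then show ?thesis using abs_nrm_diff[OF uV[of n] uV[of N]] N by linarith
  qed
  moreover have "0 \<le> ?M" by (simp add: sum_nonneg nrm_nonneg uV)
  ultimately show ?thesis by blast
qed

lemma conv_B:
  assumes uV: "\<And>n. u n \<in> V" and pV: "\<phi> \<in> V" and yV: "\<And>n. y n \<in> V" and eV: "\<eta> \<in> V"
    and u: "conv u \<phi>" and y: "conv y \<eta>"
  shows "(\<lambda>n. B (u n) (y n)) \<longlonglongrightarrow> B \<phi> \<eta>"
proof -
  let ?U = "\<lambda>n x. u n x - \<phi> x" and ?Y = "\<lambda>n x. y n x - \<eta> x"
  have UV: "?U n \<in> V" "?Y n \<in> V" for n by (simp_all add: diff_mem uV pV yV eV)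
  have "(\<lambda>n. nrm (?U n) * nrm (?Y n) + nrm (?U n) * nrm \<eta> + nrm \<phi> * nrm (?Y n))
      \<longlonglongrightarrow> 0 * 0 + 0 * nrm \<eta> + nrm \<phi> * 0"
    using u y by (intro tendsto_intros) (simp_all add: conv_iff_nrm uV pV yV eV)
  then have lim: "(\<lambda>n. nrm (?U n) * nrm (?Y n) + nrm (?U n) * nrm \<eta> + nrm \<phi> * nrm (?Y n)) \<longlonglongrightarrow> 0"
    by simp
  have "(\<lambda>n. B (u n) (y n) - B \<phi> \<eta>) \<longlonglongrightarrow> 0"
  proof (rule Lim_null_comparison[OF always_eventually lim], rule allI)
    fix n
    have "B (u n) (y n) - B \<phi> \<eta> = B (?U n) (?Y n) + B (?U n) \<eta> + B \<phi> (?Y n)"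
      using UV[of n] uV[of n] yV[of n] pV eV by (simp add: B_diff B_diff_right)
    then show "norm (B (u n) (y n) - B \<phi> \<eta>)
        \<le> nrm (?U n) * nrm (?Y n) + nrm (?U n) * nrm \<eta> + nrm \<phi> * nrm (?Y n)"
      using abs_B_le[OF UV[of n]] abs_B_le[OF UV(1)[of n] eV] abs_B_le[OF pV UV(2)[of n]]
      by (simp add: abs_le_iff)
  qed
  then show ?thesis by (simp add: LIM_zero_iff)
qed

end

lemma semi_inner_L2: "semi_inner (L2 \<Omega>) (L2_inner \<Omega>)"
proof
  fix f g h :: "'a \<Rightarrow> real" and a b :: real
  show lc: "(\<lambda>x. a * f x + b * g x) \<in> L2 \<Omega>" if "f \<in> L2 \<Omega>" "g \<in> L2 \<Omega>"
  proof -
    have "(\<lambda>x. c * k x) \<in> L2 \<Omega>" if "k \<in> L2 \<Omega>" for c k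
      using that by (auto simp: L2_def power_mult_distrib)
    then show ?thesis using L2_add_diff(1) that by blast
  qed
  show "L2_inner \<Omega> (\<lambda>x. a * f x + b * g x) h = a * L2_inner \<Omega> f h + b * L2_inner \<Omega> g h"
    if "f \<in> L2 \<Omega>" "g \<in> L2 \<Omega>" "h \<in> L2 \<Omega>"
    using L2_integrable_mult[OF that(1,3)] L2_integrable_mult[OF that(2,3)]
    by (simp add: L2_inner_def distrib_right mult.assoc)
qed (simp_all add: L2_inner_commute, simp add: L2_inner_def)

section \<open>Closures of closable forms\<close>

text \<open>\<open>weak_null\<close> is closability in a weak form: L2-null sequences with bounded
  energy tend to zero weakly for \<open>B\<close>, tested against members of \<open>D\<close>. Since
  no Cauchy condition is imposed on \<open>v\<close>, it yields both the uniqueness of limits and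
  the later pairing of a Cauchy with a bounded sequence.\<close>

locale closable_form = semi_inner D B
  for D :: "('a::euclidean_space \<Rightarrow> real) set" and B :: "('a \<Rightarrow> real) \<Rightarrow> ('a \<Rightarrow> real) \<Rightarrow> real" +
  fixes \<Omega> :: "'a set" and q :: "('a \<Rightarrow> real) \<Rightarrow> real"
  assumes D_L2: "D \<subseteq> L2 \<Omega>"
    and q_eq: "f \<in> D \<Longrightarrow> q f = B f f"
    and weak_null: "w \<in> D \<Longrightarrow> (\<And>m. v m \<in> D) \<Longrightarrow> (\<lambda>m. L2_inner \<Omega> (v m) (v m)) \<longlonglongrightarrow> 0 \<Longrightarrow>
      (\<And>m. nrm (v m) \<le> M) \<Longrightarrow> (\<lambda>m. B w (v m)) \<longlonglongrightarrow> 0"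
begin

interpretation L: semi_inner "L2 \<Omega>" "L2_inner \<Omega>" by (rule semi_inner_L2)

lemma approx_mem: "form_approx \<Omega> D q \<phi> u \<Longrightarrow> u n \<in> D"
  by (simp add: form_approx_def)

lemma approx_conv: "form_approx \<Omega> D q \<phi> u \<Longrightarrow> L.conv u \<phi>"
  by (simp add: form_approx_def L.conv_def)

lemma approx_Cauchy:
  assumes u: "form_approx \<Omega> D q \<phi> u" and "e > 0"
  shows "\<exists>N. \<forall>m\<ge>N. \<forall>n\<ge>N. nrm (\<lambda>x. u m x - u n x) < e"
proof -
  from u \<open>e > 0\<close> obtain N where *: "\<forall>m\<ge>N. \<forall>n\<ge>N. q (\<lambda>x. u m x - u n x) < e\<^sup>2"
    unfolding form_approx_def by (meson zero_less_power)
  then have "nrm (\<lambda>x. u m x - u n x) < e" if "m \<ge> N" "n \<ge> N" for m n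
  proof -
    have "B (\<lambda>x. u m x - u n x) (\<lambda>x. u m x - u n x) < e\<^sup>2"
      using * that approx_mem[OF u] by (simp add: q_eq diff_mem)
    from real_sqrt_less_mono[OF this] show ?thesis using \<open>e > 0\<close> by (simp add: nrm_def)
  qed
  then show ?thesis by blast
qed

lemma approx_bounded:
  assumes u: "form_approx \<Omega> D q \<phi> u"
  shows "\<exists>M\<ge>0. \<forall>n. nrm (u n) \<le> M"
proof -
  obtain N where "\<forall>m\<ge>N. \<forall>n\<ge>N. q (\<lambda>x. u m x - u n x) < 1"
    using u unfolding form_approx_def by (meson zero_less_one)
  then show ?thesis
    using nrm_bounded[of u N] approx_mem[OF u] by (simp add: q_eq diff_mem)
qed

lemma approxI:
  assumes "\<And>n. u n \<in> D" "L.conv u \<phi>"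
    and "\<And>e. e > 0 \<Longrightarrow> \<exists>N. \<forall>m\<ge>N. \<forall>n\<ge>N. nrm (\<lambda>x. u m x - u n x) < e"
  shows "form_approx \<Omega> D q \<phi> u"
  unfolding form_approx_def
proof (intro conjI allI impI)
  fix e :: real assume "e > 0"
  then obtain N where N: "\<forall>m\<ge>N. \<forall>n\<ge>N. nrm (\<lambda>x. u m x - u n x) < sqrt e"
    using assms(3)[of "sqrt e"] by auto
  then show "\<exists>N. \<forall>m\<ge>N. \<forall>n\<ge>N. q (\<lambda>x. u m x - u n x) < e"
    using assms(1) by (auto simp: q_eq diff_mem nrm_def)
qed (use assms in \<open>auto simp: L.conv_def\<close>)

lemma approx_lincomb:
  assumes u: "form_approx \<Omega> D q \<phi> u" and y: "form_approx \<Omega> D q \<eta> y"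
    and L2: "\<phi> \<in> L2 \<Omega>" "\<eta> \<in> L2 \<Omega>"
  shows "form_approx \<Omega> D q (\<lambda>x. a * \<phi> x + b * \<eta> x) (\<lambda>n x. a * u n x + b * y n x)"
proof (rule approxI)
  note mem = approx_mem[OF u] approx_mem[OF y]
  show "(\<lambda>x. a * u n x + b * y n x) \<in> D" for n by (rule lincomb) (rule mem)+
  show "L.conv (\<lambda>n x. a * u n x + b * y n x) (\<lambda>x. a * \<phi> x + b * \<eta> x)"
    using mem D_L2 by (intro L.conv_lincomb L2 approx_conv[OF u] approx_conv[OF y]) auto
  fix e :: real assume "e > 0"
  define e' where "e' = e / (\<bar>a\<bar> + \<bar>b\<bar> + 1)"
  have "e' > 0" using \<open>e > 0\<close> by (simp add: e'_def add_nonneg_pos)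
  obtain N1 where N1: "\<forall>m\<ge>N1. \<forall>n\<ge>N1. nrm (\<lambda>x. u m x - u n x) < e'"
    using approx_Cauchy[OF u \<open>e' > 0\<close>] by blast
  obtain N2 where N2: "\<forall>m\<ge>N2. \<forall>n\<ge>N2. nrm (\<lambda>x. y m x - y n x) < e'"
    using approx_Cauchy[OF y \<open>e' > 0\<close>] by blast
  have scale: "nrm (\<lambda>x. c * f x) = \<bar>c\<bar> * nrm f" if "f \<in> D" for c f
    using B_square_lincomb[OF that that, of c 0] by (simp add: nrm_def real_sqrt_mult)
  have "nrm (\<lambda>x. a * u m x + b * y m x - (a * u n x + b * y n x)) < e"
    if "m \<ge> max N1 N2" "n \<ge> max N1 N2" for m n
  proof -
    let ?U = "\<lambda>x. u m x - u n x" and ?Y = "\<lambda>x. y m x - y n x"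
    have U: "?U \<in> D" "?Y \<in> D" by (simp_all add: diff_mem mem)
    have "nrm (\<lambda>x. a * u m x + b * y m x - (a * u n x + b * y n x)) = nrm (\<lambda>x. a * ?U x + b * ?Y x)"
      by (rule arg_cong[of _ _ nrm]) (auto simp: algebra_simps)
    also have "\<dots> \<le> \<bar>a\<bar> * nrm ?U + \<bar>b\<bar> * nrm ?Y"
      using nrm_add[OF lincomb[OF U, of a 0] lincomb[OF U, of 0 b]] scale[OF U(1), of a] scale[OF U(2), of b]
      by simp
    also have "\<dots> \<le> \<bar>a\<bar> * e' + \<bar>b\<bar> * e'"
      using N1 N2 that by (intro add_mono mult_left_mono) (auto intro: less_imp_le)
    also have "\<dots> < (\<bar>a\<bar> + \<bar>b\<bar> + 1) * e'" using \<open>e' > 0\<close> by (simp add: algebra_simps)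
    also have "\<dots> = e" by (simp add: e'_def)
    finally show ?thesis .
  qed
  then show "\<exists>N. \<forall>m\<ge>N. \<forall>n\<ge>N. nrm (\<lambda>x. a * u m x + b * y m x - (a * u n x + b * y n x)) < e"
    by blast
qed

text \<open>Split \<open>B (u n) (u n)\<close> into \<open>B (u n) (u n - u m)\<close> and
  \<open>B (u n) (u m)\<close>. The first is small uniformly in large \<open>m\<close> by the Cauchy
  property; for fixed \<open>n\<close> the second vanishes as \<open>m\<close> grows, by
  \<open>weak_null\<close>.\<close>

lemma approx_zero:
  assumes u: "form_approx \<Omega> D q (\<lambda>x. 0) u"
  shows "(\<lambda>n. nrm (u n)) \<longlonglongrightarrow> 0"
proof -
  note mem = approx_mem[OF u]
  obtain M where M: "M \<ge> 0" "\<And>n. nrm (u n) \<le> M" using approx_bounded[OF u] by blast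
  have B0: "(\<lambda>m. B (u n) (u m)) \<longlonglongrightarrow> 0" for n
    using weak_null[OF mem mem _ M(2)] approx_conv[OF u] by (simp add: L.conv_def)
  have "(\<lambda>n. B (u n) (u n)) \<longlonglongrightarrow> 0"
  proof (rule LIMSEQ_I)
    fix e :: real assume "e > 0"
    then have "e / (2 * (M + 1)) > 0" using M(1) by simp
    from approx_Cauchy[OF u this] obtain N
      where N: "\<forall>m\<ge>N. \<forall>n\<ge>N. nrm (\<lambda>x. u m x - u n x) < e / (2 * (M + 1))" by blast
    have less: "B (u n) (u n) \<le> M * (e / (2 * (M + 1))) + 0" if "n \<ge> N" for n
    proof (rule tendsto_lowerbound)
      show "(\<lambda>m. M * (e / (2 * (M + 1))) + B (u n) (u m)) \<longlonglongrightarrow> M * (e / (2 * (M + 1))) + 0"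
        by (intro tendsto_add tendsto_const B0)
      show "\<forall>\<^sub>F m in sequentially. B (u n) (u n) \<le> M * (e / (2 * (M + 1))) + B (u n) (u m)"
        using eventually_ge_at_top[of N]
      proof eventually_elim
        case (elim m)
        have "B (u n) (u n) = B (u n) (\<lambda>x. u n x - u m x) + B (u n) (u m)"
          by (simp add: B_diff_right mem)
        also have "B (u n) (\<lambda>x. u n x - u m x) \<le> nrm (u n) * nrm (\<lambda>x. u n x - u m x)"
          using abs_B_le[OF mem[of n] diff_mem[OF mem[of n] mem[of m]]] by simp
        also have "\<dots> \<le> M * (e / (2 * (M + 1)))"
          using M N elim that by (intro mult_mono) (auto simp: nrm_nonneg mem diff_mem intro: less_imp_le)
        finally show ?case by simp
      qed
    qed simp
    have "M * (e / (2 * (M + 1))) + 0 < e"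
    proof -
      have "M * e < 2 * (M + 1) * e" using M(1) \<open>e > 0\<close> by (intro mult_strict_right_mono) auto
      then show ?thesis using M(1) by (simp add: divide_less_eq algebra_simps)
    qed
    then have "B (u n) (u n) < e" if "n \<ge> N" for n using less[OF that] by linarith
    then show "\<exists>N. \<forall>n\<ge>N. norm (B (u n) (u n) - 0) < e"
      using B_nonneg[OF mem] by (intro exI[of _ N]) simp
  qed
  then show ?thesis
    using tendsto_real_sqrt[of _ 0] unfolding nrm_def by fastforce
qed

lemma approx_B_Cauchy:
  assumes u: "form_approx \<Omega> D q \<phi> u" and y: "form_approx \<Omega> D q \<eta> y"
  shows "convergent (\<lambda>n. B (u n) (y n))"
proof -
  note mem = approx_mem[OF u] approx_mem[OF y]
  obtain M1 where M1: "M1 \<ge> 0" "\<And>n. nrm (u n) \<le> M1" using approx_bounded[OF u] by blast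
  obtain M2 where M2: "M2 \<ge> 0" "\<And>n. nrm (y n) \<le> M2" using approx_bounded[OF y] by blast
  have "Cauchy (\<lambda>n. B (u n) (y n))"
  proof (rule CauchyI)
    fix e :: real assume "e > 0"
    define e' where "e' = e / (M1 + M2 + 1)"
    have "e' > 0" using \<open>e > 0\<close> M1 M2 by (simp add: e'_def add_nonneg_pos)
    obtain N1 where N1: "\<forall>m\<ge>N1. \<forall>n\<ge>N1. nrm (\<lambda>x. u m x - u n x) < e'"
      using approx_Cauchy[OF u \<open>e' > 0\<close>] by blast
    obtain N2 where N2: "\<forall>m\<ge>N2. \<forall>n\<ge>N2. nrm (\<lambda>x. y m x - y n x) < e'"
      using approx_Cauchy[OF y \<open>e' > 0\<close>] by blast
    have "norm (B (u m) (y m) - B (u n) (y n)) < e" if "m \<ge> max N1 N2" "n \<ge> max N1 N2" for m n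
    proof -
      have "B (u m) (y m) - B (u n) (y n)
          = B (\<lambda>x. u m x - u n x) (y m) + B (u n) (\<lambda>x. y m x - y n x)"
        by (simp add: B_diff B_diff_right mem)
      then have "norm (B (u m) (y m) - B (u n) (y n))
          \<le> nrm (\<lambda>x. u m x - u n x) * nrm (y m) + nrm (u n) * nrm (\<lambda>x. y m x - y n x)"
        using abs_B_le[OF diff_mem[OF mem(1)[of m] mem(1)[of n]] mem(2)[of m]]
          abs_B_le[OF mem(1)[of n] diff_mem[OF mem(2)[of m] mem(2)[of n]]] by simp
      also have "\<dots> \<le> e' * M2 + M1 * e'"
        using M1 M2 N1 N2 that \<open>e' > 0\<close>
        by (intro add_mono mult_mono) (auto simp: nrm_nonneg diff_mem mem intro: less_imp_le)
      also have "\<dots> < (M1 + M2 + 1) * e'" using \<open>e' > 0\<close> by (simp add: algebra_simps)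
      also have "\<dots> = e" using M1 M2 by (simp add: e'_def)
      finally show ?thesis .
    qed
    then show "\<exists>N. \<forall>m\<ge>N. \<forall>n\<ge>N. norm (B (u m) (y m) - B (u n) (y n)) < e" by blast
  qed
  then show ?thesis by (simp add: Cauchy_convergent_iff)
qed

text \<open>\<open>closure_form\<close> is a definite description, so the limit must be shown to be
  independent of the sequence: the difference of two approximating sequences approximates zero, and
  \<open>approx_zero\<close> applies to it.\<close>

lemma closure_form_lim:
  assumes u: "form_approx \<Omega> D q \<phi> u" and phi: "\<phi> \<in> L2 \<Omega>"
  shows "(\<lambda>n. B (u n) (u n)) \<longlonglongrightarrow> closure_form \<Omega> D q \<phi>"
proof -
  obtain l where l: "(\<lambda>n. B (u n) (u n)) \<longlonglongrightarrow> l"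
    using approx_B_Cauchy[OF u u] by (auto simp: convergent_def)
  have "closure_form \<Omega> D q \<phi> = l"
    unfolding closure_form_def
  proof (rule the_equality)
    show "\<exists>u. form_approx \<Omega> D q \<phi> u \<and> (\<lambda>n. q (u n)) \<longlonglongrightarrow> l"
      using u l by (auto simp: q_eq approx_mem[OF u])
    fix l' assume "\<exists>u. form_approx \<Omega> D q \<phi> u \<and> (\<lambda>n. q (u n)) \<longlonglongrightarrow> l'"
    then obtain v where v: "form_approx \<Omega> D q \<phi> v" and "(\<lambda>n. q (v n)) \<longlonglongrightarrow> l'" by blast
    then have l': "(\<lambda>n. B (v n) (v n)) \<longlonglongrightarrow> l'" by (simp add: q_eq approx_mem)
    have "(\<lambda>n. nrm (\<lambda>x. u n x - v n x)) \<longlonglongrightarrow> 0"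
      using approx_zero approx_lincomb[OF u v phi phi, of 1 "-1"] by simp
    then have "(\<lambda>n. nrm (u n) - nrm (v n)) \<longlonglongrightarrow> 0"
      by (rule Lim_null_comparison[rotated]) (simp add: abs_nrm_diff approx_mem[OF u] approx_mem[OF v])
    moreover have "(\<lambda>n. nrm (u n) - nrm (v n)) \<longlonglongrightarrow> sqrt l - sqrt l'"
      unfolding nrm_def by (intro tendsto_intros l l')
    ultimately show "l' = l" using LIMSEQ_unique by fastforce
  qed
  then show ?thesis using l by simp
qed

lemma polarization_lim:
  assumes u: "form_approx \<Omega> D q \<phi> u" and y: "form_approx \<Omega> D q \<eta> y"
    and L2: "\<phi> \<in> L2 \<Omega>" "\<eta> \<in> L2 \<Omega>"
  shows "(\<lambda>n. B (u n) (y n)) \<longlonglongrightarrow> polarization (closure_form \<Omega> D q) \<phi> \<eta>"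
proof -
  note mem = approx_mem[OF u] approx_mem[OF y]
  have "(\<lambda>n. (B (\<lambda>x. u n x + y n x) (\<lambda>x. u n x + y n x) - B (\<lambda>x. u n x - y n x) (\<lambda>x. u n x - y n x)) / 4)
      \<longlonglongrightarrow> polarization (closure_form \<Omega> D q) \<phi> \<eta>"
    unfolding polarization_def
    using approx_lincomb[OF u y L2, of 1 1] approx_lincomb[OF u y L2, of 1 "-1"]
    by (intro tendsto_intros closure_form_lim) (auto simp: L2_add_diff L2)
  moreover have "(B (\<lambda>x. u n x + y n x) (\<lambda>x. u n x + y n x) - B (\<lambda>x. u n x - y n x) (\<lambda>x. u n x - y n x)) / 4
      = B (u n) (y n)" for n
    using B_square_lincomb[OF mem(1)[of n] mem(2)[of n], where a = 1 and b = 1]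
      B_square_lincomb[OF mem(1)[of n] mem(2)[of n], where a = 1 and b = "-1"] by simp
  ultimately show ?thesis by simp
qed

end

text \<open>Dyadic convex combinations of a tail of the sequence. Midpoints are all that the
  parallelogram identity requires, so no general convex weights appear.\<close>

inductive_set midpoint_hull :: "(nat \<Rightarrow> 'a \<Rightarrow> real) \<Rightarrow> nat \<Rightarrow> ('a \<Rightarrow> real) set" for v N where
  base: "N \<le> m \<Longrightarrow> v m \<in> midpoint_hull v N"
| midpoint: "f \<in> midpoint_hull v N \<Longrightarrow> g \<in> midpoint_hull v N \<Longrightarrow> (\<lambda>x. (f x + g x) / 2) \<in> midpoint_hull v N"

lemma midpoint_hull_antimono:
  assumes "f \<in> midpoint_hull v M" "N \<le> M" shows "f \<in> midpoint_hull v N"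
  using assms by induction (auto intro: midpoint_hull.intros)

context semi_inner
begin

lemma midpoint_hull_mem:
  assumes "f \<in> midpoint_hull v N" "\<And>m. v m \<in> V" shows "f \<in> V"
  using assms(1) by induction (auto intro: assms(2) midpoint_mem)

text \<open>Balls are midpoint convex by \<open>B_midpoint\<close>. With \<open>h\<close> the L2
  limit, this keeps L2 convergence when passing to hull elements; with \<open>h\<close> zero in the
  form, it keeps the energy bound.\<close>

lemma midpoint_hull_dist_le:
  assumes "f \<in> midpoint_hull v N" and vV: "\<And>m. v m \<in> V" and h: "h \<in> V"
    and le: "\<And>m. N \<le> m \<Longrightarrow> B (\<lambda>x. v m x - h x) (\<lambda>x. v m x - h x) \<le> e"
  shows "B (\<lambda>x. f x - h x) (\<lambda>x. f x - h x) \<le> e"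
  using assms(1)
proof induction
  case (midpoint f g)
  have fg: "f \<in> V" "g \<in> V" using midpoint.hyps midpoint_hull_mem vV by blast+
  have "(\<lambda>x. (f x + g x) / 2 - h x) = (\<lambda>x. ((f x - h x) + (g x - h x)) / 2)"
    by (auto simp: field_simps)
  then show ?case
    using B_midpoint[OF diff_mem[OF fg(1) h] diff_mem[OF fg(2) h]] midpoint.IH
      B_nonneg[OF diff_mem[OF diff_mem[OF fg(1) h] diff_mem[OF fg(2) h]]]
    by simp
qed (rule le)

end

context closable_form
begin

interpretation L: semi_inner "L2 \<Omega>" "L2_inner \<Omega>" by (rule semi_inner_L2)

text \<open>Banach--Saks: nearly minimizing \<open>B\<close> over the midpoint-convex hulls of the tails of a bounded
  sequence gives a Cauchy sequence, by the parallelogram identity.\<close>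

lemma closure_lower_semicontinuous:
  assumes v: "\<And>m. v m \<in> D" and f: "f \<in> L2 \<Omega>" and conv: "L.conv v f"
    and b: "\<And>m. B (v m) (v m) \<le> b m" and l: "b \<longlonglongrightarrow> l"
  shows "f \<in> closure_dom \<Omega> D q" and "closure_form \<Omega> D q f \<le> l"
proof -
  let ?C = "midpoint_hull v"
  define d where "d N = (INF f\<in>?C N. B f f)" for N
  have C: "f \<in> D" if "f \<in> ?C N" for f N using midpoint_hull_mem[OF that v] .
  have zero: "(\<lambda>x. 0) \<in> D" using diff_mem[OF v[of 0] v[of 0]] by simp
  have bdd: "bdd_below ((\<lambda>f. B f f) ` ?C N)" for N
    using C B_nonneg by (intro bdd_belowI2[of _ 0]) auto
  have dle: "d N \<le> B f f" if "f \<in> ?C N" for f N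
    unfolding d_def by (rule cINF_lower[OF bdd that])
  have ne: "?C N \<noteq> {}" for N using midpoint_hull.base[of N N v] by blast
  have "\<exists>f\<in>?C N. B f f < d N + inverse (Suc N)" for N
    using cINF_less_iff[OF ne bdd, of N "d N + inverse (Suc N)"] by (simp add: d_def)
  then obtain x where x: "\<And>N. x N \<in> ?C N" and xd: "\<And>N. B (x N) (x N) < d N + inverse (Suc N)"
    by metis
  have xD: "x N \<in> D" for N using C x by blast
  have d_mono: "d N \<le> d M" if "N \<le> M" for N M
    unfolding d_def using midpoint_hull_antimono that
    by (intro cINF_superset_mono ne bdd) blast+
  obtain K where K: "\<And>m. b m \<le> K"
    using convergent_imp_Bseq[of b] l by (auto simp: convergent_def Bseq_def abs_le_iff)
  have "d N \<le> K" for N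
    using dle[OF midpoint_hull.base[of N N v]] b[of N] K[of N] by simp
  then have "convergent d"
    using incseq_convergent[of d K] d_mono by (metis convergentI incseq_def)
  then have d_Cauchy: "Cauchy d" by (rule convergent_Cauchy)
  \<comment> \<open>The midpoint of \<open>x N\<close> and \<open>x M\<close> lies in the hull of
    tail \<open>N\<close>, so its energy is at least \<open>d N\<close>; the parallelogram identity
    turns this into closeness of the two near-minimizers.\<close>
  have close: "B (\<lambda>t. x N t - x M t) (\<lambda>t. x N t - x M t) \<le> 2 * (d M - d N) + 4 * inverse (Suc N)"
    if "N \<le> M" for N M
  proof -
    have "x M \<in> ?C N" using midpoint_hull_antimono[OF x that] .
    then have "d N \<le> B (\<lambda>t. (x N t + x M t) / 2) (\<lambda>t. (x N t + x M t) / 2)"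
      using dle midpoint_hull.midpoint x by blast
    moreover have "inverse (real (Suc M)) \<le> inverse (real (Suc N))"
      using that by (intro le_imp_inverse_le) auto
    ultimately show ?thesis
      using B_midpoint[OF xD[of N] xD[of M]] xd[of N] xd[of M] unfolding right_diff_distrib by linarith
  qed
  have approx: "form_approx \<Omega> D q f x"
  proof (rule approxI[OF xD])
    show "L.conv x f"
      unfolding L.conv_def
    proof (rule LIMSEQ_I)
      fix e :: real assume "e > 0"
      then obtain N where N: "\<And>m. N \<le> m \<Longrightarrow> L2_inner \<Omega> (\<lambda>x. v m x - f x) (\<lambda>x. v m x - f x) \<le> e / 2"
        using LIMSEQ_D[OF conv[unfolded L.conv_def], of "e / 2"] by force
      have "L2_inner \<Omega> (\<lambda>t. x n t - f t) (\<lambda>t. x n t - f t) \<le> e / 2" if "n \<ge> N" for n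
        using L.midpoint_hull_dist_le[OF midpoint_hull_antimono[OF x that] _ f N] v D_L2 by blast
      moreover have "0 \<le> L2_inner \<Omega> (\<lambda>t. x n t - f t) (\<lambda>t. x n t - f t)" for n
        using xD D_L2 f by (intro L.B_nonneg L.diff_mem) auto
      ultimately show "\<exists>N. \<forall>n\<ge>N. norm (L2_inner \<Omega> (\<lambda>t. x n t - f t) (\<lambda>t. x n t - f t) - 0) < e"
        using \<open>e > 0\<close> by (intro exI[of _ N]) fastforce
    qed
    fix e :: real assume "e > 0"
    \<comment> \<open>The budget in \<open>close\<close> is two plus four times this amount, which
      stays below \<open>e\<close> squared.\<close>
    then have e8: "e\<^sup>2 / 8 > 0" by simp
    obtain N1 where N1: "\<And>m n. m \<ge> N1 \<Longrightarrow> n \<ge> N1 \<Longrightarrow> \<bar>d m - d n\<bar> < e\<^sup>2 / 8"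
      using CauchyD[OF d_Cauchy e8] by auto
    obtain N2 where N2: "inverse (real (Suc N2)) < e\<^sup>2 / 8" using reals_Archimedean[OF e8] by blast
    have less: "nrm (\<lambda>t. x m t - x n t) < e" if "max N1 N2 \<le> m" "m \<le> n" for m n
    proof -
      have "inverse (real (Suc m)) \<le> inverse (real (Suc N2))"
        using that by (intro le_imp_inverse_le) auto
      then have "B (\<lambda>t. x m t - x n t) (\<lambda>t. x m t - x n t) < e\<^sup>2"
        using close[OF that(2)] N1[of n m] N2 that
        unfolding right_diff_distrib max.bounded_iff abs_less_iff by linarith
      then show ?thesis
        unfolding nrm_def using \<open>e > 0\<close> real_sqrt_less_mono by fastforce
    qed
    show "\<exists>N. \<forall>m\<ge>N. \<forall>n\<ge>N. nrm (\<lambda>t. x m t - x n t) < e"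
    proof (intro exI allI impI)
      fix m n assume "max N1 N2 \<le> m" "max N1 N2 \<le> n"
      then show "nrm (\<lambda>t. x m t - x n t) < e"
        using less[of m n] less[of n m] nrm_diff_commute[OF xD[of m] xD[of n]]
        by (cases "m \<le> n") auto
    qed
  qed
  then show "f \<in> closure_dom \<Omega> D q" using f by (auto simp: closure_dom_def)
  show "closure_form \<Omega> D q f \<le> l"
  proof (rule field_le_epsilon)
    fix e :: real assume "e > 0"
    then obtain N where N: "\<And>m. m \<ge> N \<Longrightarrow> b m \<le> l + e"
      using LIMSEQ_D[OF l, of e] by (force simp: abs_le_iff)
    have "B (x n) (x n) \<le> l + e" if "n \<ge> N" for n
      using midpoint_hull_dist_le[OF midpoint_hull_antimono[OF x that] v zero, of "l + e"] b N
      by simp (meson order_trans)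
    then show "closure_form \<Omega> D q f \<le> l + e"
      by (intro LIMSEQ_le_const2[OF closure_form_lim[OF approx f]]) blast
  qed
qed

text \<open>Write \<open>v\<close> as a form-approximation \<open>y\<close> of \<eta> plus a
  remainder \<open>z\<close> that is L2-null with bounded energy. Against a fixed \<open>u N\<close>
  the remainder vanishes by \<open>weak_null\<close>; replacing \<open>u n\<close> by
  \<open>u N\<close> costs little, uniformly, because \<open>u\<close> is Cauchy for the form and
  \<open>z\<close> is bounded.\<close>

lemma strong_weak_lim:
  assumes u: "form_approx \<Omega> D q \<phi> u" and phi: "\<phi> \<in> L2 \<Omega>"
    and v: "\<And>m. v m \<in> D" and eta: "\<eta> \<in> closure_dom \<Omega> D q" and conv: "L.conv v \<eta>"
    and M: "\<And>m. nrm (v m) \<le> M"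
  shows "(\<lambda>n. B (u n) (v n)) \<longlonglongrightarrow> polarization (closure_form \<Omega> D q) \<phi> \<eta>"
proof -
  obtain y where y: "form_approx \<Omega> D q \<eta> y" and eL: "\<eta> \<in> L2 \<Omega>"
    using eta by (auto simp: closure_dom_def)
  note mem = approx_mem[OF u] approx_mem[OF y]
  obtain M' where M': "\<And>n. nrm (y n) \<le> M'" using approx_bounded[OF y] by blast
  define z where "z n = (\<lambda>x. v n x - y n x)" for n
  have zD: "z n \<in> D" for n unfolding z_def by (rule diff_mem[OF v mem(2)])
  have zM: "nrm (z n) \<le> \<bar>M + M'\<bar> + 1" for n
    unfolding z_def using nrm_diff[OF v[of n] mem(2)[of n]] M[of n] M'[of n] by linarith
  have "L.conv (\<lambda>n x. 1 * v n x + (-1) * y n x) (\<lambda>x. 1 * \<eta> x + (-1) * \<eta> x)"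
    using v mem D_L2 by (intro L.conv_lincomb eL conv approx_conv[OF y]) auto
  then have z0: "(\<lambda>n. L2_inner \<Omega> (z n) (z n)) \<longlonglongrightarrow> 0" by (simp add: L.conv_def z_def)
  have "(\<lambda>n. B (u n) (z n)) \<longlonglongrightarrow> 0"
  proof (rule LIMSEQ_I)
    fix e :: real assume "e > 0"
    define e' where "e' = e / (2 * (\<bar>M + M'\<bar> + 1))"
    have "e' > 0" using \<open>e > 0\<close> by (simp add: e'_def add_nonneg_pos)
    then obtain N where N: "\<forall>m\<ge>N. \<forall>n\<ge>N. nrm (\<lambda>x. u m x - u n x) < e'"
      using approx_Cauchy[OF u] by blast
    obtain N' where N': "\<And>n. n \<ge> N' \<Longrightarrow> \<bar>B (u N) (z n)\<bar> < e / 2"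
      using LIMSEQ_D[OF weak_null[OF mem(1)[of N] zD z0 zM], of "e / 2"] \<open>e > 0\<close> by auto
    have "norm (B (u n) (z n) - 0) < e" if "n \<ge> max N N'" for n
    proof -
      have "\<bar>B (\<lambda>x. u n x - u N x) (z n)\<bar> \<le> nrm (\<lambda>x. u n x - u N x) * nrm (z n)"
        by (rule abs_B_le) (simp_all add: diff_mem mem zD)
      also have "\<dots> \<le> e' * (\<bar>M + M'\<bar> + 1)"
        using N that zM[of n] \<open>e' > 0\<close>
        by (intro mult_mono) (auto simp: nrm_nonneg zD intro: less_imp_le)
      also have "\<dots> = e / 2"
      proof -
        have "\<bar>M + M'\<bar> + 1 \<noteq> 0" by linarith
        then show ?thesis unfolding e'_def by (simp add: field_simps)
      qed
      finally show ?thesis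
        using N'[of n] that B_diff[OF mem(1)[of n] mem(1)[of N] zD[of n]]
          abs_triangle_ineq[of "B (u n) (z n) - B (u N) (z n)" "B (u N) (z n)"]
        by simp
    qed
    then show "\<exists>N. \<forall>n\<ge>N. norm (B (u n) (z n) - 0) < e" by blast
  qed
  then have "(\<lambda>n. B (u n) (z n) + B (u n) (y n)) \<longlonglongrightarrow> 0 + polarization (closure_form \<Omega> D q) \<phi> \<eta>"
    by (intro tendsto_add polarization_lim[OF u y phi eL])
  moreover have "B (u n) (z n) + B (u n) (y n) = B (u n) (v n)" for n
    unfolding z_def by (simp add: B_diff_right v mem)
  ultimately show ?thesis by simp
qed

end

section \<open>Smooth approximation of the distance to the boundary\<close>

lemma partial_eq: "(f has_derivative f') (at x) \<Longrightarrow> partial k f x = f' k"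
  unfolding partial_def using frechet_derivative_at by metis

lemma partial_add:
  assumes "f differentiable (at x)" "g differentiable (at x)"
  shows "partial k (\<lambda>x. f x + g x) x = partial k f x + partial k g x"
proof -
  obtain f' g' where f: "(f has_derivative f') (at x)" and g: "(g has_derivative g') (at x)"
    using assms unfolding differentiable_def by blast
  show ?thesis
    using partial_eq[OF has_derivative_add[OF f g]] partial_eq[OF f] partial_eq[OF g] by simp
qed

lemma partial_mult:
  fixes f g :: "'a::euclidean_space \<Rightarrow> real"
  assumes "f differentiable (at x)" "g differentiable (at x)"
  shows "partial k (\<lambda>x. f x * g x) x = f x * partial k g x + partial k f x * g x"
proof -
  obtain f' g' where f: "(f has_derivative f') (at x)" and g: "(g has_derivative g') (at x)"
    using assms unfolding differentiable_def by blast
  show ?thesis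
    using partial_eq[OF has_derivative_mult[OF f g]] partial_eq[OF f] partial_eq[OF g] by simp
qed

lemma partial_const: "partial k (\<lambda>x. c) x = 0"
  by (rule partial_eq) (rule has_derivative_const)

lemma partial_chain:
  assumes "(F has_real_derivative F') (at (f x))" "f differentiable (at x)"
  shows "partial k (\<lambda>x. F (f x)) x = F' * partial k f x"
proof -
  obtain f' where f: "(f has_derivative f') (at x)"
    using assms unfolding differentiable_def by blast
  have "((\<lambda>x. F (f x)) has_derivative (\<lambda>h. F' * f' h)) (at x)"
    using has_derivative_compose[OF f, of F "(*) F'"] assms(1)
    by (simp add: has_field_derivative_def)
  from partial_eq[OF this] partial_eq[OF f] show ?thesis by simp
qed

lemma partial_powr:
  assumes "f differentiable (at x)" "f x > 0"
  shows "partial k (\<lambda>x. f x powr p) x = p * (f x powr (p - 1) * partial k f x)"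
  using partial_chain[OF has_real_derivative_powr[OF assms(2)] assms(1)] by (simp add: mult.assoc)

lemma differentiable_powr:
  fixes f :: "'a::real_normed_vector \<Rightarrow> real"
  assumes "f differentiable (at x)" "f x > 0"
  shows "(\<lambda>x. f x powr p) differentiable (at x)"
proof -
  obtain f' where "(f has_derivative f') (at x)"
    using assms unfolding differentiable_def by blast
  from has_derivative_powr[OF this has_derivative_const assms(2) UNIV_I]
  show ?thesis unfolding differentiable_def by blast
qed

lemma partial_cong_open:
  assumes "open U" "x \<in> U" "\<And>x. x \<in> U \<Longrightarrow> f x = g x" "f differentiable (at x)"
  shows "partial k f x = partial k g x"
  using frechet_derivative_transform_within_open[OF assms(4,1,2,3)] by (simp add: partial_def)

lemma differentiable_cong_open:
  assumes "open U" "x \<in> U" "\<And>x. x \<in> U \<Longrightarrow> f x = g x" "f differentiable (at x)"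
  shows "g differentiable (at x)"
  using assms has_derivative_transform_within_open unfolding differentiable_def by metis

text \<open>Localizes \<open>times_cont_diff\<close>, since the weights are smooth on \<Omega> only.
  Derivatives are taken \<open>at x\<close> in the full space, so the rules below work on open
  sets.\<close>

fun cont_diff_on :: "nat \<Rightarrow> 'a::euclidean_space set \<Rightarrow> ('a \<Rightarrow> real) \<Rightarrow> bool" where
  "cont_diff_on 0 U f \<longleftrightarrow> continuous_on U f"
| "cont_diff_on (Suc n) U f \<longleftrightarrow>
     (\<forall>x\<in>U. f differentiable (at x)) \<and> (\<forall>k\<in>Basis. cont_diff_on n U (partial k f))"

lemma times_cont_diff_iff: "times_cont_diff n f \<longleftrightarrow> cont_diff_on n UNIV f"
  by (induction n arbitrary: f) auto

lemma cont_diff_on_cong: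
  assumes "open U" "\<And>x. x \<in> U \<Longrightarrow> f x = g x" "cont_diff_on n U f"
  shows "cont_diff_on n U g"
  using assms(2,3)
proof (induction n arbitrary: f g)
  case 0 then show ?case by (simp cong: continuous_on_cong)
next
  case (Suc n)
  have "cont_diff_on n U (partial k g)" if "k \<in> Basis" for k
    by (rule Suc.IH[of "partial k f"]) (use Suc.prems that partial_cong_open[OF assms(1)] in auto)
  then show ?case
    using Suc.prems differentiable_cong_open[OF assms(1), of _ f g] by auto
qed

lemma cont_diff_on_SucD: "cont_diff_on (Suc n) U f \<Longrightarrow> cont_diff_on n U f"
proof (induction n arbitrary: f)
  case 0
  then show ?case
    by (auto intro!: continuous_at_imp_continuous_on differentiable_imp_continuous_within)
qed auto

lemma cont_diff_on_const: "cont_diff_on n U (\<lambda>x. c)"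
proof (induction n arbitrary: c)
  case (Suc n)
  have "partial k (\<lambda>x. c) = (\<lambda>x. 0)" for k :: 'a by (rule ext) (rule partial_const)
  then show ?case using Suc by simp
qed simp

lemma cont_diff_on_affine: "cont_diff_on n U (\<lambda>x. x \<bullet> v + c)"
proof (cases n)
  case (Suc m)
  have d: "((\<lambda>x. x \<bullet> v + c) has_derivative (\<lambda>h. h \<bullet> v)) (at x)" for x
    by (auto intro!: derivative_eq_intros)
  then have "partial k (\<lambda>x. x \<bullet> v + c) = (\<lambda>x. k \<bullet> v)" for k using partial_eq[OF d] by blast
  then show ?thesis using Suc d by (auto simp: cont_diff_on_const differentiable_def)
qed (auto intro!: continuous_intros)

lemma cont_diff_on_add:
  assumes "open U" "cont_diff_on n U f" "cont_diff_on n U g"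
  shows "cont_diff_on n U (\<lambda>x. f x + g x)"
  using assms(2,3)
proof (induction n arbitrary: f g)
  case (Suc n)
  have "cont_diff_on n U (partial k (\<lambda>x. f x + g x))" if "k \<in> Basis" for k
    by (rule cont_diff_on_cong[OF assms(1) _ Suc.IH[of "partial k f" "partial k g"]])
      (use Suc.prems that in \<open>auto simp: partial_add\<close>)
  then show ?case using Suc.prems by auto
qed (auto intro: continuous_on_add)

lemma cont_diff_on_mult:
  assumes "open U" "cont_diff_on n U f" "cont_diff_on n U g"
  shows "cont_diff_on n U (\<lambda>x. f x * g x)"
  using assms(2,3)
proof (induction n arbitrary: f g)
  case (Suc n)
  note * = Suc.prems[THEN cont_diff_on_SucD]
  have "cont_diff_on n U (partial k (\<lambda>x. f x * g x))" if "k \<in> Basis" for k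
    by (rule cont_diff_on_cong[OF assms(1), of "\<lambda>x. f x * partial k g x + partial k f x * g x"])
      (use Suc that * in \<open>auto simp: partial_mult intro!: cont_diff_on_add assms(1)\<close>)
  then show ?case using Suc.prems by auto
qed (auto intro: continuous_on_mult)

text \<open>The induction must generalize the exponent, because differentiation lowers it to
  \<open>p - 1\<close>.\<close>

lemma cont_diff_on_powr:
  assumes "open U" "cont_diff_on n U f" and pos: "\<And>x. x \<in> U \<Longrightarrow> f x > 0"
  shows "cont_diff_on n U (\<lambda>x. f x powr p)"
  using assms(2)
proof (induction n arbitrary: p)
  case 0 then show ?case using pos by (fastforce intro!: continuous_intros)
next
  case (Suc n)
  note * = Suc.IH[OF cont_diff_on_SucD[OF Suc.prems]]
  have "cont_diff_on n U (partial k (\<lambda>x. f x powr p))" if "k \<in> Basis" for k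
    by (rule cont_diff_on_cong[OF assms(1), of "\<lambda>x. p * (f x powr (p - 1) * partial k f x)"])
      (use Suc.prems that * pos in \<open>auto simp: partial_powr
        intro!: cont_diff_on_mult cont_diff_on_const assms(1)\<close>)
  then show ?case using Suc.prems pos by (auto intro: differentiable_powr)
qed

lemma cont_diff_on_sum:
  assumes "open U" "finite Y" "\<And>y. y \<in> Y \<Longrightarrow> cont_diff_on n U (f y)"
  shows "cont_diff_on n U (\<lambda>x. \<Sum>y\<in>Y. f y x)"
  using assms(2,3)
  by (induction Y) (auto intro!: cont_diff_on_const cont_diff_on_add assms(1))

text \<open>Gluing rule for products with a test function, which are smooth on \<Omega> and vanish
  on the complement of a compact set.\<close>

lemma cont_diff_on_Un:
  "open U \<Longrightarrow> open W \<Longrightarrow> cont_diff_on n U f \<Longrightarrow> cont_diff_on n W f \<Longrightarrow> cont_diff_on n (U \<union> W) f"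
  by (induction n arbitrary: f) (auto intro: continuous_on_open_Un)

lemma cont_diff_on_subset: "cont_diff_on n W f \<Longrightarrow> U \<subseteq> W \<Longrightarrow> cont_diff_on n U f"
  by (induction n arbitrary: f) (auto intro: continuous_on_subset)

lemma cont_diff_on_norm_power:
  fixes y :: "'a::euclidean_space"
  assumes "open U" shows "cont_diff_on n U (\<lambda>x. (norm (x - y))\<^sup>2)"
proof -
  have "(norm (x - y))\<^sup>2 = (\<Sum>i\<in>Basis. (x \<bullet> i + - (y \<bullet> i)) * (x \<bullet> i + - (y \<bullet> i)))" for x :: 'a
    unfolding power2_norm_eq_inner by (subst euclidean_inner) (simp add: inner_diff_left)
  then show ?thesis
    by (simp only:) (intro cont_diff_on_sum cont_diff_on_mult cont_diff_on_affine assms finite_Basis)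
qed

section \<open>The smooth minimum of finitely many distances\<close>

lemma sum_Basis_inner_power2:
  fixes G :: "'a::euclidean_space" shows "(\<Sum>k\<in>Basis. (G \<bullet> k)\<^sup>2) = (norm G)\<^sup>2"
  unfolding power2_norm_eq_inner by (subst euclidean_inner) (simp add: power2_eq_square)

text \<open>The exponent p of the overview is \<open>1 / t\<close>, so large p means small
  \<open>t\<close>. Powers are taken of the squared norm because that is a polynomial in the
  coordinates.\<close>

definition soft_min :: "'a::euclidean_space set \<Rightarrow> real \<Rightarrow> 'a \<Rightarrow> real" where
  "soft_min Y t = (\<lambda>x. (\<Sum>y\<in>Y. ((norm (x - y))\<^sup>2) powr (-1 / (2 * t))) powr (- t))"

text \<open>Keeping only one summand bounds the value above by each distance; bounding all summands
  by the one for distance \<open>d\<close> gives the lower bound. The gradient estimate feeds the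
  upper bound for the value back into the derivative, so that the constant is exactly 1.\<close>

lemma soft_min:
  fixes Y :: "'a::euclidean_space set" and U :: "'a set" and t :: real
  assumes U: "open U" and fin: "finite Y" and ne: "Y \<noteq> {}" and disj: "Y \<inter> U = {}" and t: "t > 0"
  shows "cont_diff_on n U (soft_min Y t)"
    and "x \<in> U \<Longrightarrow> soft_min Y t x > 0"
    and "x \<in> U \<Longrightarrow> (\<Sum>k\<in>Basis. (partial k (soft_min Y t) x)\<^sup>2) \<le> 1"
    and "x \<in> U \<Longrightarrow> y \<in> Y \<Longrightarrow> soft_min Y t x \<le> norm (x - y)"
    and "x \<in> U \<Longrightarrow> d > 0 \<Longrightarrow> (\<And>y. y \<in> Y \<Longrightarrow> d \<le> norm (x - y)) \<Longrightarrow> real (card Y) powr (- t) * d \<le> soft_min Y t x"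
proof -
  let ?q = "1 / (2 * t)"
  define P where "P = (\<lambda>x::'a. \<Sum>y\<in>Y. ((norm (x - y))\<^sup>2) powr (-1 / (2 * t)))"
  define S where "S = (\<lambda>x. P x powr (- t))"
  have soft_min_eq: "soft_min Y t = S" by (simp add: S_def soft_min_def P_def)
  have pos: "norm (x - y) > 0" if "x \<in> U" "y \<in> Y" for x y using that disj by auto
  have Ppos: "P x > 0" if "x \<in> U" for x
    unfolding P_def using fin ne pos[OF that] by (intro sum_pos) auto
  show "cont_diff_on n U (soft_min Y t)"
    unfolding soft_min_eq S_def P_def
    by (intro cont_diff_on_powr cont_diff_on_sum cont_diff_on_norm_power U fin)
      (use Ppos pos in \<open>auto simp: P_def\<close>)
  show "soft_min Y t x > 0" if "x \<in> U" for x unfolding soft_min_eq S_def using Ppos[OF that] by simp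
  have S_le: "S x \<le> norm (x - y)" if "x \<in> U" "y \<in> Y" for x y
  proof -
    have n: "norm (x - y) > 0" using pos that by blast
    have "((norm (x - y))\<^sup>2) powr (-1 / (2 * t)) \<le> P x"
      unfolding P_def by (rule member_le_sum) (use fin that in auto)
    then have "S x \<le> (((norm (x - y))\<^sup>2) powr (-1 / (2 * t))) powr (- t)"
      unfolding S_def using n t by (intro powr_mono2') auto
    also have "\<dots> = norm (x - y)"
      using n t by (simp add: powr_powr powr_half_sqrt)
    finally show ?thesis .
  qed
  show "soft_min Y t x \<le> norm (x - y)" if "x \<in> U" "y \<in> Y" for x y
    unfolding soft_min_eq using S_le that .
  show "real (card Y) powr (- t) * d \<le> soft_min Y t x"
    if "x \<in> U" "d > 0" and le: "\<And>y. y \<in> Y \<Longrightarrow> d \<le> norm (x - y)"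
  proof -
    have "P x \<le> (\<Sum>y\<in>Y. (d\<^sup>2) powr (-1 / (2 * t)))"
      unfolding P_def using t le \<open>d > 0\<close> by (intro sum_mono powr_mono2' power_mono) (auto intro: less_imp_le)
    then have "(real (card Y) * (d\<^sup>2) powr (-1 / (2 * t))) powr (- t) \<le> S x"
      unfolding S_def using Ppos[OF \<open>x \<in> U\<close>] t by (intro powr_mono2') auto
    moreover have "(real (card Y) * (d\<^sup>2) powr (-1 / (2 * t))) powr (- t) = real (card Y) powr (- t) * d"
      using t \<open>d > 0\<close> by (simp add: powr_mult powr_powr powr_half_sqrt)
    ultimately show ?thesis unfolding soft_min_eq by simp
  qed
  show "(\<Sum>k\<in>Basis. (partial k (soft_min Y t) x)\<^sup>2) \<le> 1" if x: "x \<in> U"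
  proof -
    let ?r = "\<lambda>y. (norm (x - y))\<^sup>2"
    \<comment> \<open>The gradient of \<open>S\<close>: the factors \<open>- t\<close> and
      \<open>- 1 / t\<close> from the outer and inner powers cancel.\<close>
    define G where "G = (P x powr (- t - 1)) *\<^sub>R (\<Sum>y\<in>Y. (?r y powr (-?q - 1)) *\<^sub>R (x - y))"
    have "((\<lambda>x. (norm (x - y))\<^sup>2) has_derivative (\<lambda>h. 2 * ((x - y) \<bullet> h))) (at x)" for y
      unfolding power2_norm_eq_inner
      by (auto intro!: derivative_eq_intros simp: inner_commute)
    note d = this
    have nd: "(\<lambda>x. (norm (x - y))\<^sup>2) differentiable (at x)"
        "partial k (\<lambda>x. (norm (x - y))\<^sup>2) x = 2 * ((x - y) \<bullet> k)" for y k
      using d[of y] partial_eq[OF d[of y], of k] by (simp_all only: differentiableI)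
    have pd: "(\<lambda>x. (norm (x - y))\<^sup>2 powr (-1 / (2 * t))) differentiable (at x)"
        "partial k (\<lambda>x. (norm (x - y))\<^sup>2 powr (-1 / (2 * t))) x
          = -1 / (2 * t) * (?r y powr (-?q - 1) * (2 * ((x - y) \<bullet> k)))" if "y \<in> Y" for y k
    proof -
      have p: "(norm (x - y))\<^sup>2 > 0" using pos[OF x that] by simp
      show "(\<lambda>x. (norm (x - y))\<^sup>2 powr (-1 / (2 * t))) differentiable (at x)"
        by (rule differentiable_powr[OF nd(1) p])
      show "partial k (\<lambda>x. (norm (x - y))\<^sup>2 powr (-1 / (2 * t))) x
          = -1 / (2 * t) * (?r y powr (-?q - 1) * (2 * ((x - y) \<bullet> k)))"
        using partial_powr[OF nd(1) p, of k "-1 / (2 * t)"] by (simp add: nd(2))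
    qed
    have Pd: "P differentiable (at x)"
      unfolding P_def using pd fin by (intro differentiable_sum) auto
    have sum: "partial k (\<lambda>x. \<Sum>y\<in>Z. ((norm (x - y))\<^sup>2) powr (-1 / (2 * t))) x
        = (\<Sum>y\<in>Z. -1 / (2 * t) * (?r y powr (-?q - 1) * (2 * ((x - y) \<bullet> k))))"
      if "Z \<subseteq> Y" for k Z
      using finite_subset[OF that fin] that
    proof induction
      case (insert z Z)
      then have "(\<lambda>x. \<Sum>y\<in>Z. ((norm (x - y))\<^sup>2) powr (-1 / (2 * t))) differentiable (at x)"
        using pd by (intro differentiable_sum) auto
      then show ?case
        using insert pd by (simp add: partial_add)
    qed (simp add: partial_const)
    have "partial k S x = G \<bullet> k" for k
    proof -
      have "partial k S x = - t * (P x powr (- t - 1) * partial k P x)"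
        unfolding S_def by (rule partial_powr[OF Pd Ppos[OF x]])
      also have "partial k P x = (\<Sum>y\<in>Y. -1 / (2 * t) * (?r y powr (-?q - 1) * (2 * ((x - y) \<bullet> k))))"
        unfolding P_def by (rule sum) simp
      also have "\<dots> = - (1 / t) * (\<Sum>y\<in>Y. ?r y powr (-?q - 1) * ((x - y) \<bullet> k))"
        unfolding sum_distrib_left by (intro sum.cong) auto
      finally show ?thesis
        using t by (simp add: G_def inner_sum_left)
    qed
    moreover have "norm G \<le> 1"
    proof -
      have "norm G \<le> P x powr (- t - 1) * (\<Sum>y\<in>Y. ?r y powr (-?q - 1) * norm (x - y))"
      proof -
        have "norm (\<Sum>y\<in>Y. (?r y powr (-?q - 1)) *\<^sub>R (x - y)) \<le> (\<Sum>y\<in>Y. ?r y powr (-?q - 1) * norm (x - y))"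
          by (rule order_trans[OF norm_sum]) simp
        then show ?thesis
          unfolding G_def norm_scaleR by (simp add: mult_left_mono)
      qed
      also have "\<dots> = inverse (P x) * (\<Sum>y\<in>Y. S x * (?r y powr (-?q - 1) * norm (x - y)))"
      proof -
        have "P x powr (- t - 1) = inverse (P x) * S x"
          using Ppos[OF x] by (simp add: S_def powr_diff divide_inverse)
        then show ?thesis by (simp only: mult.assoc sum_distrib_left)
      qed
      \<comment> \<open>Trading the factor \<open>S x\<close> for the larger
        \<open>norm (x - y)\<close> restores the exponent of the summands of
        \<open>P x\<close>.\<close>
      also have "\<dots> \<le> inverse (P x) * (\<Sum>y\<in>Y. norm (x - y) * (?r y powr (-?q - 1) * norm (x - y)))"
        using Ppos[OF x] S_le[OF x] by (intro mult_left_mono sum_mono mult_right_mono) auto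
      also have "\<dots> = inverse (P x) * P x"
      proof -
        have "norm (x - y) * (?r y powr (-?q - 1) * norm (x - y)) = ?r y powr (-1 / (2 * t))"
          if "y \<in> Y" for y
        proof -
          have "norm (x - y) * (?r y powr (-?q - 1) * norm (x - y)) = ?r y * ?r y powr (-?q - 1)"
            by (simp add: power2_eq_square mult_ac)
          also have "\<dots> = ?r y powr (1 + (-?q - 1))" by (rule powr_mult_base) simp
          also have "1 + (-?q - 1) = -1 / (2 * t)" by simp
          finally show ?thesis .
        qed
        then have "(\<Sum>y\<in>Y. norm (x - y) * (?r y powr (-?q - 1) * norm (x - y))) = P x"
          unfolding P_def by (intro sum.cong refl)
        then show ?thesis by (simp only:)
      qed
      also have "\<dots> = 1" using Ppos[OF x] by simp
      finally show ?thesis .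
    qed
    ultimately show ?thesis
      unfolding soft_min_eq by (simp add: sum_Basis_inner_power2 power_le_one)
  qed
qed

lemma bdist_pos: "open \<Omega> \<Longrightarrow> \<Omega> \<noteq> UNIV \<Longrightarrow> x \<in> \<Omega> \<Longrightarrow> bdist \<Omega> x > 0"
  unfolding bdist_def
  by (metis Compl_empty_eq closed_Compl double_complement in_closed_iff_infdist_zero infdist_pos_not_in_closed ComplD)

lemma continuous_on_bdist: "continuous_on A (bdist \<Omega>)"
  unfolding bdist_def by (intro continuous_intros)

text \<open>The finite set consists of almost nearest points of the complement, one for each centre
  of a finite net of \<open>K\<close>. The smooth minimum never exceeds the distance to any of them,
  and it is at least \<open>card Z powr (- t)\<close> times the boundary distance, which is close to
  it for small \<open>t\<close>.\<close>

lemma smooth_approx_bdist: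
  fixes \<Omega> K :: "'a::euclidean_space set"
  assumes \<Omega>: "open \<Omega>" "\<Omega> \<noteq> UNIV" and K: "compact K" "K \<subseteq> \<Omega>" and "e > 0"
  obtains S where "\<And>n. cont_diff_on n \<Omega> S" "\<And>x. x \<in> \<Omega> \<Longrightarrow> S x > 0"
    "\<And>x. x \<in> \<Omega> \<Longrightarrow> (\<Sum>k\<in>Basis. (partial k S x)\<^sup>2) \<le> 1"
    "\<And>x. x \<in> K \<Longrightarrow> \<bar>S x - bdist \<Omega> x\<bar> < e"
proof -
  have C: "- \<Omega> \<noteq> {}" using \<Omega> by auto
  obtain y0 where y0: "y0 \<in> - \<Omega>" using C by blast
  have "\<exists>y. y \<in> - \<Omega> \<and> dist x y < bdist \<Omega> x + e / 3" for x
  proof -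
    obtain y where "y \<in> - \<Omega>" "infdist x (- \<Omega>) = dist x y"
      using infdist_attains_inf[of "- \<Omega>" x] \<Omega> C by blast
    then show ?thesis using \<open>e > 0\<close> by (intro exI[of _ y]) (simp add: bdist_def)
  qed
  then have "\<exists>Y. \<forall>x. Y x \<in> - \<Omega> \<and> dist x (Y x) < bdist \<Omega> x + e / 3"
    by (intro choice allI)
  then obtain Y where Y: "\<And>x. Y x \<in> - \<Omega>" "\<And>x. dist x (Y x) < bdist \<Omega> x + e / 3" by blast
  obtain C where C: "C \<subseteq> K" "finite C" "K \<subseteq> (\<Union>x\<in>C. ball x (e / 3))"
    using compactE_image[OF K(1), of K "\<lambda>x. ball x (e / 3)"] \<open>e > 0\<close> by force
  \<comment> \<open>The point \<open>y0\<close> keeps the set nonempty when \<open>K\<close> is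
    empty.\<close>
  define Z where "Z = insert y0 (Y ` C)"
  have Z: "finite Z" "Z \<noteq> {}" "Z \<inter> \<Omega> = {}" using C Y y0 by (auto simp: Z_def)
  have near: "\<exists>y\<in>Z. norm (x - y) < bdist \<Omega> x + e" if "x \<in> K" for x
  proof -
    have "x \<in> (\<Union>x\<in>C. ball x (e / 3))" using C(3) that by blast
    then obtain c where c: "c \<in> C" "dist c x < e / 3" by (auto simp: mem_ball)
    \<comment> \<open>Three errors of \<open>e / 3\<close>: from \<open>x\<close> to
      \<open>c\<close>, the slack in the choice of \<open>Y c\<close>, and the change of the
      boundary distance from \<open>c\<close> to \<open>x\<close>.\<close>
    have "dist x (Y c) < bdist \<Omega> c + e / 3 + e / 3"
      using dist_triangle[of x "Y c" c] Y(2)[of c] c(2) by (simp add: dist_commute)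
    also have "bdist \<Omega> c \<le> bdist \<Omega> x + e / 3"
      using infdist_triangle[of c "-\<Omega>" x] c(2) by (simp add: bdist_def)
    finally show ?thesis using c(1) by (intro bexI[of _ "Y c"]) (auto simp: Z_def dist_norm)
  qed
  have far: "bdist \<Omega> x \<le> norm (x - y)" if "y \<in> Z" for x y
    using infdist_le[of y "- \<Omega>" x] Z(3) that by (auto simp: bdist_def dist_norm)
  have "bounded (bdist \<Omega> ` K)"
    by (intro compact_imp_bounded compact_continuous_image continuous_on_bdist K)
  then obtain D where D: "D > 0" "\<And>x. x \<in> K \<Longrightarrow> \<bar>bdist \<Omega> x\<bar> \<le> D"
    by (auto simp: bounded_pos)
  have card: "card Z \<ge> 1" using Z by (simp add: Suc_leI card_gt_0_iff)
  then have ln: "ln (real (card Z)) \<ge> 0" by simp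
  \<comment> \<open>Chosen so that the loss \<open>t * ln (card Z) * D\<close> is at most
    \<open>e / 2\<close>; the added 1 keeps the denominator positive when \<open>Z\<close> is a
    single point.\<close>
  define t where "t = e / (2 * D * (ln (real (card Z)) + 1))"
  have den: "2 * D * (ln (real (card Z)) + 1) > 0" using D ln by simp
  then have t: "t > 0" unfolding t_def using \<open>e > 0\<close> by simp
  define S where "S = soft_min Z t"
  note sm = soft_min[OF \<Omega>(1) Z t, folded S_def]
  have "\<bar>S x - bdist \<Omega> x\<bar> < e" if "x \<in> K" for x
  proof -
    have x: "x \<in> \<Omega>" using that K by blast
    have d: "bdist \<Omega> x > 0" using bdist_pos \<Omega> x by blast
    \<comment> \<open>The tangent line of the exponential linearizes
      \<open>card Z powr (- t)\<close>.\<close>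
    have "1 - t * ln (real (card Z)) \<le> exp (- t * ln (real (card Z)))"
      using exp_ge_add_one_self[of "- t * ln (real (card Z))"] by simp
    also have "\<dots> = real (card Z) powr (- t)"
      using card by (simp add: powr_def)
    finally have "(1 - t * ln (real (card Z))) * bdist \<Omega> x \<le> real (card Z) powr (- t) * bdist \<Omega> x"
      using d by (intro mult_right_mono) auto
    also have "\<dots> \<le> S x" by (rule sm(5)[OF x d]) (rule far)
    finally have "(1 - t * ln (real (card Z))) * bdist \<Omega> x \<le> S x" .
    moreover have "t * ln (real (card Z)) * bdist \<Omega> x < e"
    proof -
      have "t * ln (real (card Z)) * bdist \<Omega> x \<le> t * (ln (real (card Z)) + 1) * D"
        using t ln d D(2)[OF that] by (intro mult_mono) auto
      also have "\<dots> = e / 2" unfolding t_def using den ln D by (simp add: field_simps)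
      finally show ?thesis using \<open>e > 0\<close> by simp
    qed
    moreover obtain y where "y \<in> Z" "norm (x - y) < bdist \<Omega> x + e" using near[OF \<open>x \<in> K\<close>] by blast
    moreover have "S x \<le> norm (x - y)" using sm(4) x \<open>y \<in> Z\<close> by blast
    ultimately show ?thesis by (simp add: algebra_simps abs_less_iff)
  qed
  then show thesis using that[of S] sm(1-3) by blast
qed

section \<open>Test functions and closability\<close>

lemma test_functionsI:
  assumes "\<And>n. cont_diff_on n UNIV \<phi>" "compact K" "K \<subseteq> \<Omega>" "\<And>x. x \<notin> K \<Longrightarrow> \<phi> x = 0"
  shows "\<phi> \<in> test_functions \<Omega>"
proof -
  have "closure {x. \<phi> x \<noteq> 0} \<subseteq> K"
    using assms by (intro closure_minimal) (auto intro: compact_imp_closed)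
  moreover from this have "compact (closure {x. \<phi> x \<noteq> 0})"
    using compact_Int_closed[OF assms(2), of "closure {x. \<phi> x \<noteq> 0}"] by (simp add: inf.absorb2)
  ultimately show ?thesis
    using assms by (auto simp: test_functions_def times_cont_diff_iff)
qed

lemma test_support:
  assumes "\<phi> \<in> test_functions \<Omega>"
  shows "\<exists>K. compact K \<and> K \<subseteq> \<Omega> \<and> (\<forall>x. x \<notin> K \<longrightarrow> \<phi> x = 0)"
proof (intro exI conjI allI impI)
  show "compact (closure {x. \<phi> x \<noteq> 0})" "closure {x. \<phi> x \<noteq> 0} \<subseteq> \<Omega>"
    using assms by (simp_all add: test_functions_def)
  fix x assume "x \<notin> closure {x. \<phi> x \<noteq> 0}"
  then show "\<phi> x = 0" using closure_subset[of "{x. \<phi> x \<noteq> 0}"] by blast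
qed

lemma test_cont_diff: "\<phi> \<in> test_functions \<Omega> \<Longrightarrow> cont_diff_on n UNIV \<phi>"
  by (auto simp: test_functions_def times_cont_diff_iff)

lemma test_differentiable: "\<phi> \<in> test_functions \<Omega> \<Longrightarrow> \<phi> differentiable (at x)"
  using test_cont_diff[of \<phi> \<Omega> "Suc 0"] by simp

lemma test_continuous: "\<phi> \<in> test_functions \<Omega> \<Longrightarrow> continuous_on A \<phi>"
  using test_cont_diff[of \<phi> \<Omega> 0] by (auto intro: continuous_on_subset)

text \<open>The factor \<open>g\<close> may blow up at the boundary of \<Omega>. The product is
  smooth on \<Omega> and zero on the complement of the support, and these two open sets cover the
  space.\<close>

lemma test_smooth_mult:
  assumes "open \<Omega>" "\<phi> \<in> test_functions \<Omega>" "\<And>n. cont_diff_on n \<Omega> g"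
  shows "(\<lambda>x. g x * \<phi> x) \<in> test_functions \<Omega>"
proof -
  obtain K where K: "compact K" "K \<subseteq> \<Omega>" "\<And>x. x \<notin> K \<Longrightarrow> \<phi> x = 0"
    using test_support[OF assms(2)] by blast
  show ?thesis
  proof (rule test_functionsI[OF _ K(1,2)])
    fix n
    have o: "open (- K)" using K by (simp add: compact_imp_closed open_Compl)
    have "cont_diff_on n \<Omega> (\<lambda>x. g x * \<phi> x)"
      by (intro cont_diff_on_mult assms cont_diff_on_subset[OF test_cont_diff[OF assms(2)]]) simp
    moreover have "cont_diff_on n (- K) (\<lambda>x. g x * \<phi> x)"
      by (rule cont_diff_on_cong[OF o _ cont_diff_on_const[of n "- K" 0]]) (simp add: K)
    moreover have "\<Omega> \<union> - K = UNIV" using K by blast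
    ultimately show "cont_diff_on n UNIV (\<lambda>x. g x * \<phi> x)"
      using cont_diff_on_Un[OF assms(1) o, of n "\<lambda>x. g x * \<phi> x"] by simp
  qed (simp add: K)
qed

lemma partial_eq_0_outside:
  assumes "closed K" "\<And>x. x \<notin> K \<Longrightarrow> \<phi> x = 0" "x \<notin> K"
  shows "partial k \<phi> x = 0"
proof -
  have "partial k (\<lambda>x. 0) x = partial k \<phi> x"
    by (rule partial_cong_open[of "- K"]) (use assms in \<open>auto simp: open_Compl\<close>)
  then show ?thesis by (simp add: partial_const)
qed

lemma test_partial:
  assumes "\<phi> \<in> test_functions \<Omega>" "k \<in> Basis"
  shows "partial k \<phi> \<in> test_functions \<Omega>"
proof -
  obtain K where K: "compact K" "K \<subseteq> \<Omega>" "\<And>x. x \<notin> K \<Longrightarrow> \<phi> x = 0"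
    using test_support[OF assms(1)] by blast
  have "cont_diff_on n UNIV (partial k \<phi>)" for n using test_cont_diff[OF assms(1), of "Suc n"] assms(2) by simp
  then show ?thesis
    using K by (intro test_functionsI[OF _ K(1,2)]) (auto intro: partial_eq_0_outside compact_imp_closed)
qed

lemma test_lincomb:
  assumes "f \<in> test_functions \<Omega>" "g \<in> test_functions \<Omega>"
  shows "(\<lambda>x. a * f x + b * g x) \<in> test_functions \<Omega>"
proof -
  obtain K where K: "compact K" "K \<subseteq> \<Omega>" "\<And>x. x \<notin> K \<Longrightarrow> f x = 0"
    using test_support[OF assms(1)] by blast
  obtain L where L: "compact L" "L \<subseteq> \<Omega>" "\<And>x. x \<notin> L \<Longrightarrow> g x = 0"
    using test_support[OF assms(2)] by blast
  show ?thesis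
    by (rule test_functionsI[of _ "K \<union> L"])
      (use K L in \<open>auto intro!: cont_diff_on_add[OF open_UNIV] cont_diff_on_mult[OF open_UNIV]
        cont_diff_on_const test_cont_diff[OF assms(1)] test_cont_diff[OF assms(2)]\<close>)
qed

lemma integrable_compact_support:
  fixes f :: "'a::euclidean_space \<Rightarrow> real"
  assumes \<Omega>: "open \<Omega>" and K: "compact K" "K \<subseteq> \<Omega>" and f: "continuous_on \<Omega> f" "\<And>x. x \<notin> K \<Longrightarrow> f x = 0"
  shows "integrable (lebesgue_on \<Omega>) f"
proof -
  have i: "integrable lborel (\<lambda>x. indicator K x *\<^sub>R f x)"
    using K f by (intro borel_integrable_compact) (auto intro: continuous_on_subset)
  then have "integrable lebesgue (\<lambda>x. indicator K x *\<^sub>R f x)"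
    by (subst integrable_completion) auto
  moreover have "(\<lambda>x. indicator K x *\<^sub>R f x) = (\<lambda>x. indicator \<Omega> x *\<^sub>R f x)"
    using K f by (intro ext) (auto simp: indicator_def)
  ultimately show ?thesis using \<Omega> by (subst integrable_restrict_space) auto
qed

lemma test_L2:
  assumes "open \<Omega>" "\<phi> \<in> test_functions \<Omega>" shows "\<phi> \<in> L2 \<Omega>"
proof -
  obtain K where K: "compact K" "K \<subseteq> \<Omega>" "\<And>x. x \<notin> K \<Longrightarrow> \<phi> x = 0"
    using test_support[OF assms(2)] by blast
  have "integrable (lebesgue_on \<Omega>) \<phi>" "integrable (lebesgue_on \<Omega>) (\<lambda>x. (\<phi> x)\<^sup>2)"
    using K test_continuous[OF assms(2)]
    by (auto intro!: integrable_compact_support[OF assms(1) K(1,2)] continuous_intros)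
  then show ?thesis by (simp add: L2_def)
qed

section \<open>Integration by parts\<close>

lemma has_real_derivative_line:
  assumes "f differentiable (at (x + t *\<^sub>R k))"
  shows "((\<lambda>t. f (x + t *\<^sub>R k)) has_real_derivative partial k f (x + t *\<^sub>R k)) (at t)"
proof -
  obtain f' where f: "(f has_derivative f') (at (x + t *\<^sub>R k))"
    using assms unfolding differentiable_def by blast
  have "((\<lambda>t. x + t *\<^sub>R k) has_derivative (\<lambda>s. s *\<^sub>R k)) (at t)"
    by (auto intro!: derivative_eq_intros)
  from has_derivative_compose[OF this f]
  have "((\<lambda>t. f (x + t *\<^sub>R k)) has_derivative (\<lambda>s. s * f' k)) (at t)"
    using linear_cmul[OF has_derivative_linear[OF f]] by simp
  moreover have "(\<lambda>s. s * f' k) = (*) (partial k f (x + t *\<^sub>R k))"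
    using partial_eq[OF f] by (auto simp: mult.commute)
  ultimately show ?thesis by (simp add: has_field_derivative_def)
qed

text \<open>Difference quotients of a compactly supported function have integral zero by translation
  invariance, and they converge dominatedly to the partial derivative.\<close>

lemma integral_partial_eq_0:
  fixes f :: "'a::euclidean_space \<Rightarrow> real"
  assumes f: "f \<in> test_functions UNIV" and k: "k \<in> Basis"
  shows "(LINT x|lborel. partial k f x) = 0"
proof -
  obtain K where K: "compact K" "\<And>x. x \<notin> K \<Longrightarrow> f x = 0"
    using test_support[OF f] by blast
  define h where "h n = inverse (real (Suc n))" for n
  have h: "0 < h n" "h n \<le> 1" for n by (auto simp: h_def inverse_le_1_iff)
  have h0: "filterlim h (at 0) sequentially"
  proof (rule filterlim_atI)
    show "h \<longlonglongrightarrow> 0" unfolding h_def by (rule LIMSEQ_inverse_real_of_nat)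
    show "\<forall>\<^sub>F n in sequentially. h n \<noteq> 0" by (simp add: h_def)
  qed
  obtain R where R: "\<And>x. x \<in> K \<Longrightarrow> norm x \<le> R"
    using compact_imp_bounded[OF K(1)] by (auto simp: bounded_iff)
  note pk = test_partial[OF f k]
  obtain L where L: "compact L" "\<And>x. x \<notin> L \<Longrightarrow> partial k f x = 0"
    using test_support[OF pk] by blast
  have "bounded (partial k f ` L)"
    by (intro compact_imp_bounded compact_continuous_image L test_continuous[OF pk])
  then obtain C where C: "C > 0" "\<And>x. x \<in> L \<Longrightarrow> \<bar>partial k f x\<bar> \<le> C"
    by (auto simp: bounded_pos)
  have C': "\<bar>partial k f x\<bar> \<le> C" for x using C L(2)[of x] by (cases "x \<in> L") auto
  define s where "s n x = (f (x + h n *\<^sub>R k) - f x) / h n" for n x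
  have cf: "continuous_on UNIV f" by (rule test_continuous[OF f])
  have meas: "g \<in> borel_measurable lborel" if "continuous_on UNIV g" for g :: "'a \<Rightarrow> real"
    using borel_measurable_continuous_onI[OF that] by simp
  have intf: "integrable lborel f"
  proof -
    have "integrable lborel (\<lambda>x. indicator K x *\<^sub>R f x)"
      by (intro borel_integrable_compact K test_continuous[OF f])
    moreover have "(\<lambda>x. indicator K x *\<^sub>R f x) = f" using K by (intro ext) (auto simp: indicator_def)
    ultimately show ?thesis by simp
  qed
  have shift: "integrable lborel (\<lambda>x. f (x + a))" "(LINT x|lborel. f (x + a)) = (LINT x|lborel. f x)" for a
  proof -
    have m: "(+) a \<in> measurable lborel borel" "f \<in> borel_measurable borel"
      using cf by (auto intro: borel_measurable_continuous_onI)
    show "integrable lborel (\<lambda>x. f (x + a))"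
      using integrable_distr_eq[OF m] intf by (simp add: lborel_distr_plus add.commute)
    show "(LINT x|lborel. f (x + a)) = (LINT x|lborel. f x)"
      using integral_distr[OF m] by (simp add: lborel_distr_plus add.commute)
  qed
  have s0: "(LINT x|lborel. s n x) = 0" for n
    unfolding s_def using shift intf by simp
  have "(\<lambda>n. LINT x|lborel. s n x) \<longlonglongrightarrow> (LINT x|lborel. partial k f x)"
  proof (rule integral_dominated_convergence)
    show "partial k f \<in> borel_measurable lborel" by (intro meas test_continuous[OF pk])
    show "s n \<in> borel_measurable lborel" for n
      unfolding s_def using h(1)[of n]
      by (intro meas continuous_intros continuous_on_compose2[OF cf]) auto
    \<comment> \<open>By the mean value theorem each quotient is bounded by the supremum
      \<open>C\<close> of the partial derivative. It vanishes outside radius \<open>R + 1\<close>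
      because the steps \<open>h n\<close> are at most 1.\<close>
    show "integrable lborel (\<lambda>x. indicator (cball 0 (R + 1)) x *\<^sub>R C)"
      by (intro borel_integrable_compact) auto
    show "AE x in lborel. (\<lambda>n. s n x) \<longlonglongrightarrow> partial k f x"
    proof (rule AE_I2)
      fix x
      have "((\<lambda>t. (f (x + t *\<^sub>R k) - f x) / t) \<longlongrightarrow> partial k f x) (at 0)"
        using has_real_derivative_line[of f x 0 k] test_differentiable[OF f]
        by (simp add: has_field_derivative_iff)
      from filterlim_compose[OF this h0] show "(\<lambda>n. s n x) \<longlonglongrightarrow> partial k f x"
        by (simp add: s_def)
    qed
    show "AE x in lborel. norm (s n x) \<le> indicator (cball 0 (R + 1)) x *\<^sub>R C" for n
    proof (rule AE_I2)
      fix x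
      show "norm (s n x) \<le> indicator (cball 0 (R + 1)) x *\<^sub>R C"
      proof (cases "norm x \<le> R + 1")
        case True
        have "((\<lambda>t. f (x + t *\<^sub>R k)) has_real_derivative partial k f (x + t *\<^sub>R k)) (at t)" for t
          by (rule has_real_derivative_line) (rule test_differentiable[OF f])
        then obtain z where "f (x + h n *\<^sub>R k) - f (x + 0 *\<^sub>R k) = (h n - 0) * partial k f (x + z *\<^sub>R k)"
          using MVT2[OF h(1)[of n], of "\<lambda>t. f (x + t *\<^sub>R k)" "\<lambda>t. partial k f (x + t *\<^sub>R k)"] by blast
        then have "s n x = partial k f (x + z *\<^sub>R k)" using h(1)[of n] by (simp add: s_def)
        then show ?thesis using C' True by simp
      next
        case False
        then have "x \<notin> K" using R[of x] by auto
        moreover have "norm (h n *\<^sub>R k) \<le> 1" using k h[of n] by simp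
        then have "norm (x + h n *\<^sub>R k) > R"
          using False norm_triangle_ineq4[of "x + h n *\<^sub>R k" "h n *\<^sub>R k"] by simp
        then have "x + h n *\<^sub>R k \<notin> K" using R by force
        ultimately show ?thesis using False K by (simp add: s_def)
      qed
    qed
  qed
  then show ?thesis using s0 by (simp add: LIMSEQ_const_iff)
qed

text \<open>The product is a test function on the whole space, so its partial derivative integrates
  to zero; as it is supported in \<Omega>, the integral over \<Omega> is the one over the
  space.\<close>

lemma integration_by_parts:
  fixes \<Omega> :: "'a::euclidean_space set"
  assumes \<Omega>: "open \<Omega>" and f: "f \<in> test_functions \<Omega>" and g: "g \<in> test_functions \<Omega>" and k: "k \<in> Basis"
  shows "L2_inner \<Omega> f (partial k g) = - L2_inner \<Omega> (partial k f) g"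
proof -
  let ?p = "\<lambda>x. f x * g x"
  have p: "?p \<in> test_functions \<Omega>"
    by (rule test_smooth_mult[OF \<Omega> g]) (rule cont_diff_on_subset[OF test_cont_diff[OF f]], simp)
  then have p': "?p \<in> test_functions UNIV" by (auto simp: test_functions_def)
  have pk: "partial k ?p x = f x * partial k g x + partial k f x * g x" for x
    using f g by (intro partial_mult test_differentiable)
  note L = L2_integrable_mult[OF test_L2[OF \<Omega>] test_L2[OF \<Omega>]]
  have "L2_inner \<Omega> f (partial k g) + L2_inner \<Omega> (partial k f) g = (LINT x|lebesgue_on \<Omega>. partial k ?p x)"
    unfolding pk L2_inner_def using L[OF f test_partial[OF g k]] L[OF test_partial[OF f k] g] by simp
  also have "\<dots> = (LINT x|lebesgue. indicator \<Omega> x *\<^sub>R partial k ?p x)"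
    using \<Omega> by (intro integral_restrict_space) auto
  also have "(\<lambda>x. indicator \<Omega> x *\<^sub>R partial k ?p x) = partial k ?p"
  proof -
    obtain K where "K \<subseteq> \<Omega>" "\<And>x. x \<notin> K \<Longrightarrow> partial k ?p x = 0"
      using test_support[OF test_partial[OF p k]] by blast
    then show ?thesis by (intro ext) (auto simp: indicator_def)
  qed
  also have "(LINT x|lebesgue. partial k ?p x) = (LINT x|lborel. partial k ?p x)"
    using borel_measurable_continuous_onI[OF test_continuous[OF test_partial[OF p k], of UNIV]]
    by (intro integral_completion) simp
  also have "\<dots> = 0" by (rule integral_partial_eq_0[OF p' k])
  finally show ?thesis by simp
qed

section \<open>The energy on test functions\<close>

definition grad_inner :: "('a::euclidean_space \<Rightarrow> real) \<Rightarrow> ('a \<Rightarrow> real) \<Rightarrow> 'a \<Rightarrow> real" where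
  "grad_inner f g x = (\<Sum>k\<in>Basis. partial k f x * partial k g x)"

lemma grad_inner_self_nonneg: "0 \<le> grad_inner f f x"
  by (simp add: grad_inner_def sum_nonneg)

text \<open>The gradient of g^2 f paired with that of f already contains the full cross term 2 g f
  (grad f . grad g), so the two sides differ by f^2 |grad g|^2 only. This produces the error term c
  |grad \<chi>|^2 \<phi>^2 of the overview.\<close>

lemma grad_inner_mult:
  assumes "f differentiable (at x)" "g differentiable (at x)"
  shows "grad_inner (\<lambda>x. g x * f x) (\<lambda>x. g x * f x) x
    = grad_inner f (\<lambda>x. g x * (g x * f x)) x + (f x)\<^sup>2 * grad_inner g g x"
proof -
  have gf: "(\<lambda>x. g x * f x) differentiable (at x)" using assms by simp
  show ?thesis
    unfolding grad_inner_def sum_distrib_left sum.distrib[symmetric]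
    by (intro sum.cong refl) (simp add: partial_mult assms gf power2_eq_square algebra_simps)
qed

locale degenerate_form =
  fixes \<Omega> :: "'a::euclidean_space set" and \<delta> \<delta>' :: real
  assumes open_domain: "open \<Omega>" and proper: "\<Omega> \<noteq> UNIV"
begin

abbreviation c :: "'a \<Rightarrow> real" where "c \<equiv> coef_on \<delta> \<delta>' \<Omega>"
abbreviation d :: "'a \<Rightarrow> real" where "d \<equiv> bdist \<Omega>"
abbreviation T :: "('a \<Rightarrow> real) set" where "T \<equiv> test_functions \<Omega>"

lemma d_pos: "x \<in> \<Omega> \<Longrightarrow> d x > 0"
  using bdist_pos open_domain proper .

lemma c_eq: "c x = coef \<delta> \<delta>' (d x)"
  by (simp add: coef_on_def)

lemma coef_pos: "s > 0 \<Longrightarrow> coef \<delta> \<delta>' s > 0"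
  by (simp add: coef_def)

lemma c_pos: "x \<in> \<Omega> \<Longrightarrow> c x > 0"
  by (simp add: c_eq coef_pos d_pos)

lemma continuous_on_coef: "continuous_on {0<..} (coef \<delta> \<delta>')"
  unfolding coef_def by (intro continuous_intros) auto

lemma continuous_on_c: "continuous_on \<Omega> c"
  unfolding coef_on_def
  by (intro continuous_on_compose continuous_on_bdist continuous_on_subset[OF continuous_on_coef])
    (auto simp: d_pos)

text \<open>On \<open>K\<close> the boundary distance takes values in a compact subinterval of the
  positive reals; \<open>G\<close> is uniformly continuous on a slightly larger one, which also
  contains the values of \<open>S\<close>. A general target space allows several functions of the
  distance to be controlled by one \<open>S\<close>.\<close>

lemma smooth_substitute:
  fixes G :: "real \<Rightarrow> 'b::metric_space"
  assumes K: "compact K" "K \<subseteq> \<Omega>" and G: "continuous_on {0<..} G" and "e > 0"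
  shows "\<exists>S. (\<forall>n. cont_diff_on n \<Omega> S) \<and> (\<forall>x\<in>\<Omega>. S x > 0 \<and> grad_inner S S x \<le> 1) \<and>
    (\<forall>x\<in>K. dist (G (S x)) (G (d x)) < e)"
proof -
  have "\<exists>r>0. \<forall>x\<in>K. \<forall>s. \<bar>s - d x\<bar> < r \<longrightarrow> dist (G s) (G (d x)) < e"
  proof (cases "K = {}")
    case False
    obtain x0 where x0: "x0 \<in> K" "\<And>x. x \<in> K \<Longrightarrow> d x0 \<le> d x"
      using continuous_attains_inf[OF K(1) False continuous_on_bdist] by blast
    obtain x1 where x1: "\<And>x. x \<in> K \<Longrightarrow> d x \<le> d x1"
      using continuous_attains_sup[OF K(1) False continuous_on_bdist] by blast
    have a: "d x0 > 0" using x0 K d_pos by blast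
    have "uniformly_continuous_on {d x0 / 2..d x1 + 1} G"
      by (intro compact_uniformly_continuous continuous_on_subset[OF G]) (use a in auto)
    then obtain r where r: "r > 0" "\<And>s s'. s \<in> {d x0 / 2..d x1 + 1} \<Longrightarrow> s' \<in> {d x0 / 2..d x1 + 1} \<Longrightarrow>
        \<bar>s' - s\<bar> < r \<Longrightarrow> dist (G s') (G s) < e"
      using \<open>e > 0\<close> unfolding uniformly_continuous_on_def dist_real_def by metis
    show ?thesis
    proof (intro exI[of _ "min r (min (d x0 / 2) 1)"] conjI ballI allI impI)
      fix x s assume "x \<in> K" "\<bar>s - d x\<bar> < min r (min (d x0 / 2) 1)"
      then show "dist (G s) (G (d x)) < e"
        using x0(2)[of x] x1[of x] a unfolding min_less_iff_conj abs_less_iff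
        by (intro r(2)) (auto simp: abs_less_iff)
    qed (use r a in auto)
  qed (auto intro: exI[of _ 1])
  then obtain r where r: "r > 0" "\<And>x s. x \<in> K \<Longrightarrow> \<bar>s - d x\<bar> < r \<Longrightarrow> dist (G s) (G (d x)) < e"
    by blast
  obtain S where S: "\<And>n. cont_diff_on n \<Omega> S" "\<And>x. x \<in> \<Omega> \<Longrightarrow> S x > 0"
    "\<And>x. x \<in> \<Omega> \<Longrightarrow> (\<Sum>k\<in>Basis. (partial k S x)\<^sup>2) \<le> 1" "\<And>x. x \<in> K \<Longrightarrow> \<bar>S x - d x\<bar> < r"
    using smooth_approx_bdist[OF open_domain proper K r(1)] by blast
  show ?thesis
    by (rule exI[of _ S]) (use S r in \<open>auto simp: grad_inner_def power2_eq_square\<close>)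
qed

definition energy :: "('a \<Rightarrow> real) \<Rightarrow> ('a \<Rightarrow> real) \<Rightarrow> real" where
  "energy f g = (LINT x|lebesgue_on \<Omega>. c x * grad_inner f g x)"

lemma continuous_on_grad_inner: "f \<in> T \<Longrightarrow> g \<in> T \<Longrightarrow> continuous_on A (grad_inner f g)"
  unfolding grad_inner_def
  by (intro continuous_intros test_continuous[OF test_partial])

lemma grad_inner_support:
  assumes "f \<in> T"
  shows "\<exists>K. compact K \<and> K \<subseteq> \<Omega> \<and> (\<forall>x k. x \<notin> K \<longrightarrow> f x = 0 \<and> partial k f x = 0)"
proof -
  obtain K where K: "compact K" "K \<subseteq> \<Omega>" "\<And>x. x \<notin> K \<Longrightarrow> f x = 0"
    using test_support[OF assms] by blast
  have "partial k f x = 0" if "x \<notin> K" for x k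
    using partial_eq_0_outside[of K f x k] compact_imp_closed K that by blast
  then show ?thesis using K by blast
qed

lemma integrable_energy:
  assumes w: "continuous_on \<Omega> w" and f: "f \<in> T" and g: "g \<in> T"
  shows "integrable (lebesgue_on \<Omega>) (\<lambda>x. w x * grad_inner f g x)"
proof -
  obtain K where K: "compact K" "K \<subseteq> \<Omega>" "\<And>x k. x \<notin> K \<Longrightarrow> partial k f x = 0"
    using grad_inner_support[OF f] by blast
  show ?thesis
    by (rule integrable_compact_support[OF open_domain K(1,2)])
      (use K w continuous_on_grad_inner[OF f g] in \<open>auto intro!: continuous_on_mult simp: grad_inner_def[of f]\<close>)
qed

lemma integrable_partial_mult:
  assumes w: "continuous_on \<Omega> w" and f: "f \<in> T" and g: "g \<in> T" and k: "k \<in> Basis"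
  shows "integrable (lebesgue_on \<Omega>) (\<lambda>x. w x * (partial k f x * partial k g x))"
proof -
  obtain K where K: "compact K" "K \<subseteq> \<Omega>" "\<And>x. x \<notin> K \<Longrightarrow> partial k f x = 0"
    using grad_inner_support[OF f] by blast
  show ?thesis
    by (rule integrable_compact_support[OF open_domain K(1,2)])
      (use K w test_continuous[OF test_partial[OF f k]] test_continuous[OF test_partial[OF g k]]
        in \<open>auto intro!: continuous_intros\<close>)
qed

lemma integral_grad_inner:
  assumes w: "continuous_on \<Omega> w" and f: "f \<in> T" and g: "g \<in> T"
  shows "(LINT x|lebesgue_on \<Omega>. w x * grad_inner f g x)
    = (\<Sum>k\<in>Basis. LINT x|lebesgue_on \<Omega>. w x * (partial k f x * partial k g x))"
  unfolding grad_inner_def sum_distrib_left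
  by (rule Bochner_Integration.integral_sum) (rule integrable_partial_mult[OF assms])

lemma pre_form_eq: "f \<in> T \<Longrightarrow> pre_form \<delta> \<delta>' \<Omega> f = energy f f"
  unfolding energy_def pre_form_def L2_inner_def
  by (subst integral_grad_inner[OF continuous_on_c]) (simp_all add: mult_ac)

lemma grad_inner_lincomb:
  assumes "f \<in> T" "g \<in> T"
  shows "grad_inner (\<lambda>x. a * f x + b * g x) h x = a * grad_inner f h x + b * grad_inner g h x"
proof -
  have 1: "partial k (\<lambda>x. e * p x) x = e * partial k p x" if "p \<in> T" for k p e
    using partial_mult[of "\<lambda>x. e" x p k] test_differentiable[OF that] by (simp add: partial_const)
  have "partial k (\<lambda>x. a * f x + b * g x) x = a * partial k f x + b * partial k g x" for k
    using partial_add[of "\<lambda>x. a * f x" x "\<lambda>x. b * g x" k] assms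
    by (simp add: 1 test_differentiable[OF assms(1)] test_differentiable[OF assms(2)])
  then show ?thesis
    unfolding grad_inner_def sum_distrib_left sum.distrib[symmetric]
    by (simp add: algebra_simps)
qed

sublocale E: semi_inner T energy
proof
  fix f g h :: "'a \<Rightarrow> real" and a b :: real
  show "(\<lambda>x. a * f x + b * g x) \<in> T" if "f \<in> T" "g \<in> T" using that by (rule test_lincomb)
  show "energy (\<lambda>x. a * f x + b * g x) h = a * energy f h + b * energy g h"
    if "f \<in> T" "g \<in> T" "h \<in> T"
  proof -
    have "energy (\<lambda>x. a * f x + b * g x) h
        = (LINT x|lebesgue_on \<Omega>. a * (c x * grad_inner f h x) + b * (c x * grad_inner g h x))"
      unfolding energy_def grad_inner_lincomb[OF that(1,2)] by (simp add: algebra_simps)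
    also have "\<dots> = a * energy f h + b * energy g h"
      unfolding energy_def
      using integrable_energy[OF continuous_on_c that(1,3)] integrable_energy[OF continuous_on_c that(2,3)]
      by simp
    finally show ?thesis .
  qed
  show "energy f g = energy g f" by (simp add: energy_def grad_inner_def mult.commute)
  show "0 \<le> energy f f"
    unfolding energy_def
    by (intro Bochner_Integration.integral_nonneg mult_nonneg_nonneg grad_inner_self_nonneg)
      (auto intro: less_imp_le[OF c_pos])
qed

interpretation L: semi_inner "L2 \<Omega>" "L2_inner \<Omega>" by (rule semi_inner_L2)

lemma T_L2: "f \<in> T \<Longrightarrow> f \<in> L2 \<Omega>"
  by (rule test_L2[OF open_domain])

lemma cont_diff_imp_continuous: "(\<And>n. cont_diff_on n A f) \<Longrightarrow> continuous_on A f"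
  using cont_diff_on.simps(1) by blast

lemma L2_inner_null:
  assumes "\<psi> \<in> L2 \<Omega>" "\<And>m. v m \<in> L2 \<Omega>" "(\<lambda>m. L2_inner \<Omega> (v m) (v m)) \<longlonglongrightarrow> 0"
  shows "(\<lambda>m. L2_inner \<Omega> \<psi> (v m)) \<longlonglongrightarrow> 0"
proof (rule Lim_null_comparison)
  show "\<forall>\<^sub>F m in sequentially. norm (L2_inner \<Omega> \<psi> (v m)) \<le> L.nrm \<psi> * L.nrm (v m)"
    using L.abs_B_le assms by simp
  have "(\<lambda>m. L.nrm \<psi> * L.nrm (v m)) \<longlonglongrightarrow> L.nrm \<psi> * sqrt 0"
    unfolding L.nrm_def by (intro tendsto_intros assms)
  then show "(\<lambda>m. L.nrm \<psi> * L.nrm (v m)) \<longlonglongrightarrow> 0" by simp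
qed

text \<open>Closability: since \<open>c\<close> need not be differentiable, it is replaced by a smooth function
  before integrating by parts.\<close>

lemma energy_weak_null:
  assumes w: "w \<in> T" and v: "\<And>m. v m \<in> T" and v0: "(\<lambda>m. L2_inner \<Omega> (v m) (v m)) \<longlonglongrightarrow> 0"
    and M: "\<And>m. E.nrm (v m) \<le> M"
  shows "(\<lambda>m. energy w (v m)) \<longlonglongrightarrow> 0"
proof (rule LIMSEQ_I)
  fix e :: real assume "e > 0"
  obtain K where K: "compact K" "K \<subseteq> \<Omega>" and Kw: "\<And>x k. x \<notin> K \<Longrightarrow> partial k w x = 0"
    using grad_inner_support[OF w] by blast
  \<comment> \<open>Makes the total cost \<open>r / 2 * (energy w w + M^2 + 1)\<close> of replacing
    the coefficient equal to \<open>e / 2\<close>.\<close>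
  define r where "r = e / (energy w w + M\<^sup>2 + 1)"
  have den: "energy w w + M\<^sup>2 + 1 > 0" using E.B_nonneg[OF w] by (simp add: add_nonneg_pos)
  then have "r > 0" using \<open>e > 0\<close> by (simp add: r_def)
  \<comment> \<open>A positive lower bound for \<open>c\<close> on \<open>K\<close> turns the
    uniform error into an error relative to \<open>c\<close>, which can then be absorbed by the
    energies.\<close>
  have "\<exists>m>0. \<forall>x\<in>K. m \<le> c x"
  proof (cases "K = {}")
    case False
    obtain x0 where "x0 \<in> K" "\<And>x. x \<in> K \<Longrightarrow> c x0 \<le> c x"
      using continuous_attains_inf[OF K(1) False continuous_on_subset[OF continuous_on_c K(2)]] by blast
    then show ?thesis using c_pos K(2) by blast
  qed (auto intro: exI[of _ 1])
  then obtain m0 where m0: "m0 > 0" "\<And>x. x \<in> K \<Longrightarrow> m0 \<le> c x" by blast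
  obtain S where S: "\<And>n. cont_diff_on n \<Omega> S" "\<And>x. x \<in> \<Omega> \<Longrightarrow> S x > 0"
    and near: "\<And>x. x \<in> K \<Longrightarrow> dist (coef \<delta> \<delta>' (S x)) (coef \<delta> \<delta>' (d x)) < r * m0"
    using smooth_substitute[OF K continuous_on_coef mult_pos_pos[OF \<open>r > 0\<close> m0(1)]] by blast
  define b where "b x = coef \<delta> \<delta>' (S x)" for x
  have b: "cont_diff_on n \<Omega> b" for n
    unfolding b_def coef_def
    by (intro cont_diff_on_mult cont_diff_on_powr cont_diff_on_add cont_diff_on_const S open_domain)
      (use S(2) in \<open>auto simp: add_pos_pos\<close>)
  note cb = cont_diff_imp_continuous[of \<Omega> b, OF b]
  have near': "\<bar>c x - b x\<bar> \<le> r * c x" if "x \<in> K" for x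
  proof -
    have "r * m0 \<le> r * c x" using m0(2)[OF that] \<open>r > 0\<close> by (intro mult_left_mono) auto
    moreover have "\<bar>c x - b x\<bar> < r * m0"
      using near[OF that] by (simp add: b_def c_eq dist_real_def abs_minus_commute)
    ultimately show ?thesis by linarith
  qed
  \<comment> \<open>The bound has to be uniform in \<open>m\<close>; off \<open>K\<close> the
    gradient of \<open>w\<close> vanishes, so closeness of \<open>b\<close> to \<open>c\<close> on
    \<open>K\<close> is enough.\<close>
  have diff: "\<bar>energy w (v m) - (LINT x|lebesgue_on \<Omega>. b x * grad_inner w (v m) x)\<bar> \<le> e / 2" for m
  proof -
    let ?v = "v m"
    have i: "integrable (lebesgue_on \<Omega>) (\<lambda>x. c x * grad_inner w ?v x)"
      "integrable (lebesgue_on \<Omega>) (\<lambda>x. b x * grad_inner w ?v x)"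
      "integrable (lebesgue_on \<Omega>) (\<lambda>x. c x * grad_inner w w x)"
      "integrable (lebesgue_on \<Omega>) (\<lambda>x. c x * grad_inner ?v ?v x)"
      using integrable_energy[OF continuous_on_c] integrable_energy[OF cb] w v by blast+
    have "\<bar>energy w ?v - (LINT x|lebesgue_on \<Omega>. b x * grad_inner w ?v x)\<bar>
        = norm (LINT x|lebesgue_on \<Omega>. c x * grad_inner w ?v x - b x * grad_inner w ?v x)"
      unfolding energy_def using i by simp
    also have "\<dots> \<le> (LINT x|lebesgue_on \<Omega>. r / 2 * (c x * grad_inner w w x) + r / 2 * (c x * grad_inner ?v ?v x))"
    proof (rule Bochner_Integration.integral_norm_bound_integral)
      fix x assume "x \<in> space (lebesgue_on \<Omega>)"
      then have x: "x \<in> \<Omega>" by simp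
      show "norm (c x * grad_inner w ?v x - b x * grad_inner w ?v x)
          \<le> r / 2 * (c x * grad_inner w w x) + r / 2 * (c x * grad_inner ?v ?v x)"
      proof (cases "x \<in> K")
        case True
        have "\<bar>grad_inner w ?v x\<bar> \<le> (\<Sum>k\<in>Basis. \<bar>partial k w x * partial k ?v x\<bar>)"
          unfolding grad_inner_def by (rule sum_abs)
        also have "\<dots> \<le> (\<Sum>k\<in>Basis. (partial k w x * partial k w x + partial k ?v x * partial k ?v x) / 2)"
        proof (rule sum_mono)
          fix k
          show "\<bar>partial k w x * partial k ?v x\<bar>
              \<le> (partial k w x * partial k w x + partial k ?v x * partial k ?v x) / 2"
            using sum_squares_bound[of "\<bar>partial k w x\<bar>" "\<bar>partial k ?v x\<bar>"]
            by (simp add: abs_mult power2_eq_square)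
        qed
        also have "\<dots> = (grad_inner w w x + grad_inner ?v ?v x) / 2"
          by (simp add: grad_inner_def sum_divide_distrib[symmetric] sum.distrib)
        finally have g: "\<bar>grad_inner w ?v x\<bar> \<le> (grad_inner w w x + grad_inner ?v ?v x) / 2" .
        have "norm (c x * grad_inner w ?v x - b x * grad_inner w ?v x) = \<bar>c x - b x\<bar> * \<bar>grad_inner w ?v x\<bar>"
          by (simp add: abs_mult[symmetric] algebra_simps)
        also have "\<dots> \<le> (r * c x) * ((grad_inner w w x + grad_inner ?v ?v x) / 2)"
          using near'[OF True] g by (intro mult_mono) auto
        finally show ?thesis by (simp add: field_simps)
      next
        case False
        then show ?thesis
          using Kw \<open>r > 0\<close> less_imp_le[OF c_pos[OF x]] grad_inner_self_nonneg[of ?v x]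
          by (simp add: grad_inner_def[of w])
      qed
    qed (use i in auto)
    also have "\<dots> = r / 2 * (energy w w + energy ?v ?v)"
      using i by (simp add: energy_def distrib_left)
    also have "\<dots> \<le> r / 2 * (energy w w + M\<^sup>2 + 1)"
    proof -
      have "energy ?v ?v \<le> M\<^sup>2"
        using power_mono[OF M E.nrm_nonneg, of m 2] v by (simp add: E.nrm_square)
      then show ?thesis using \<open>r > 0\<close> by (intro mult_left_mono) auto
    qed
    also have "\<dots> = e / 2"
    proof -
      have "r * (energy w w + M\<^sup>2 + 1) = e" using den by (simp add: r_def)
      then show ?thesis by simp
    qed
    finally show ?thesis .
  qed
  \<comment> \<open>With the smooth coefficient, integration by parts moves all derivatives onto the
    fixed function \<open>w\<close>, leaving \<open>v m\<close> undifferentiated and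
    L2-null.\<close>
  have "(\<lambda>m. LINT x|lebesgue_on \<Omega>. b x * grad_inner w (v m) x) \<longlonglongrightarrow> 0"
  proof -
    have bw: "(\<lambda>x. b x * partial k w x) \<in> T" if "k \<in> Basis" for k
      by (rule test_smooth_mult[OF open_domain test_partial[OF w that] b])
    have "(LINT x|lebesgue_on \<Omega>. b x * grad_inner w (v m) x)
        = (\<Sum>k\<in>Basis. - L2_inner \<Omega> (partial k (\<lambda>x. b x * partial k w x)) (v m))" for m
    proof -
      have "(LINT x|lebesgue_on \<Omega>. b x * grad_inner w (v m) x)
          = (\<Sum>k\<in>Basis. L2_inner \<Omega> (\<lambda>x. b x * partial k w x) (partial k (v m)))"
        by (simp add: integral_grad_inner[OF cb w v] L2_inner_def mult.assoc)
      also have "\<dots> = (\<Sum>k\<in>Basis. - L2_inner \<Omega> (partial k (\<lambda>x. b x * partial k w x)) (v m))"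
        using integration_by_parts[OF open_domain bw v] by (intro sum.cong) auto
      finally show ?thesis .
    qed
    moreover have "(\<lambda>m. \<Sum>k\<in>Basis. - L2_inner \<Omega> (partial k (\<lambda>x. b x * partial k w x)) (v m))
        \<longlonglongrightarrow> (\<Sum>k\<in>(Basis::'a set). - 0)"
      by (intro tendsto_sum tendsto_minus L2_inner_null v0 T_L2 v test_partial bw)
    ultimately show ?thesis by simp
  qed
  from LIMSEQ_D[OF this, of "e / 2"] \<open>e > 0\<close>
  obtain N where N: "\<And>m. m \<ge> N \<Longrightarrow> \<bar>LINT x|lebesgue_on \<Omega>. b x * grad_inner w (v m) x\<bar> < e / 2" by auto
  have "norm (energy w (v m) - 0) < e" if "m \<ge> N" for m
    using N[OF that] diff[of m] by (simp add: abs_if split: if_splits)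
  then show "\<exists>N. \<forall>m\<ge>N. norm (energy w (v m) - 0) < e" by blast
qed

sublocale E: closable_form T energy \<Omega> "pre_form \<delta> \<delta>' \<Omega>"
  by unfold_locales (auto simp: pre_form_eq intro: T_L2 energy_weak_null)

end

section \<open>The Rellich inequality\<close>

text \<open>The bound is asked only where \<open>f\<close> is nonzero, because a smooth weight is
  close to its target only on the support of the current test function.\<close>

lemma L2_bounded_mult:
  assumes f: "f \<in> L2 \<Omega>" and w: "w \<in> borel_measurable (lebesgue_on \<Omega>)"
    and bound: "\<And>x. x \<in> \<Omega> \<Longrightarrow> f x \<noteq> 0 \<Longrightarrow> (w x)\<^sup>2 \<le> A"
  shows "(\<lambda>x. w x * f x) \<in> L2 \<Omega>"
    and "L2_inner \<Omega> (\<lambda>x. w x * f x) (\<lambda>x. w x * f x) \<le> A * L2_inner \<Omega> f f"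
proof -
  have m: "(\<lambda>x. w x * f x) \<in> borel_measurable (lebesgue_on \<Omega>)"
    using f w by (auto simp: L2_def)
  have fi: "integrable (lebesgue_on \<Omega>) (\<lambda>x. A * (f x)\<^sup>2)" using f by (simp add: L2_def)
  have le: "(w x * f x)\<^sup>2 \<le> A * (f x)\<^sup>2" if "x \<in> \<Omega>" for x
    using bound[OF that] by (cases "f x = 0") (simp_all add: power_mult_distrib mult_right_mono)
  have i: "integrable (lebesgue_on \<Omega>) (\<lambda>x. (w x * f x)\<^sup>2)"
  proof (rule Bochner_Integration.integrable_bound[OF fi])
    show "AE x in lebesgue_on \<Omega>. norm ((w x * f x)\<^sup>2) \<le> norm (A * (f x)\<^sup>2)"
      using le by (intro AE_I2) (fastforce intro: order_trans[OF _ abs_ge_self])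
  qed (use m in auto)
  with m show "(\<lambda>x. w x * f x) \<in> L2 \<Omega>" by (simp add: L2_def)
  have "(LINT x|lebesgue_on \<Omega>. (w x * f x)\<^sup>2) \<le> (LINT x|lebesgue_on \<Omega>. A * (f x)\<^sup>2)"
    by (rule integral_mono[OF i fi]) (use le in simp)
  then show "L2_inner \<Omega> (\<lambda>x. w x * f x) (\<lambda>x. w x * f x) \<le> A * L2_inner \<Omega> f f"
    by (simp add: L2_inner_def power2_eq_square)
qed

lemma L2_inner_self: "L2_inner \<Omega> f f = (LINT x|lebesgue_on \<Omega>. (f x)\<^sup>2)"
  by (simp add: L2_inner_def power2_eq_square)

text \<open>Split p u - w \<phi> into (p - w) u and w (u - \<phi>). The first is small because the
  weights are uniformly close on the support of \<open>u m\<close>, the second because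
  \<open>w\<close> is bounded.\<close>

lemma L2_conv_mult:
  fixes e :: "nat \<Rightarrow> real"
  assumes u: "\<And>m. u m \<in> L2 \<Omega>" and phi: "\<phi> \<in> L2 \<Omega>" and conv: "semi_inner.conv (L2_inner \<Omega>) u \<phi>"
    and p: "\<And>m. p m \<in> borel_measurable (lebesgue_on \<Omega>)" and w: "w \<in> borel_measurable (lebesgue_on \<Omega>)"
    and near: "\<And>m x. x \<in> \<Omega> \<Longrightarrow> u m x \<noteq> 0 \<Longrightarrow> \<bar>p m x - w x\<bar> \<le> e m" and e: "e \<longlonglongrightarrow> 0"
    and bound: "\<And>x. x \<in> \<Omega> \<Longrightarrow> (w x)\<^sup>2 \<le> A"
  shows "semi_inner.conv (L2_inner \<Omega>) (\<lambda>m x. p m x * u m x) (\<lambda>x. w x * \<phi> x)"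
proof -
  interpret L: semi_inner "L2 \<Omega>" "L2_inner \<Omega>" by (rule semi_inner_L2)
  let ?X = "\<lambda>m x. (p m x - w x) * u m x" and ?Y = "\<lambda>m x. w x * (u m x - \<phi> x)"
  have sq: "(p m x - w x)\<^sup>2 \<le> (e m)\<^sup>2" if "x \<in> \<Omega>" "u m x \<noteq> 0" for m x
    using near[OF that] abs_le_square_iff[of "p m x - w x" "e m"] by linarith
  note X = L2_bounded_mult[of "u _" \<Omega> "\<lambda>x. p _ x - w x", OF u borel_measurable_diff[OF p w] sq]
  note Y = L2_bounded_mult[of "\<lambda>x. u _ x - \<phi> x" \<Omega> w A, OF L.diff_mem[OF u phi] w bound]
  have lim0: "(\<lambda>m. L2_inner \<Omega> (?X m) (?X m)) \<longlonglongrightarrow> 0" "(\<lambda>m. L2_inner \<Omega> (?Y m) (?Y m)) \<longlonglongrightarrow> 0"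
  proof -
    have "(\<lambda>m. (e m)\<^sup>2 * L2_inner \<Omega> (u m) (u m)) \<longlonglongrightarrow> 0\<^sup>2 * L2_inner \<Omega> \<phi> \<phi>"
      by (intro tendsto_intros e L.conv_B u phi conv)
    then have "(\<lambda>m. (e m)\<^sup>2 * L2_inner \<Omega> (u m) (u m)) \<longlonglongrightarrow> 0" by simp
    then show "(\<lambda>m. L2_inner \<Omega> (?X m) (?X m)) \<longlonglongrightarrow> 0"
      by (rule Lim_null_comparison[rotated]) (simp add: X L.B_nonneg)
    have "(\<lambda>m. A * L2_inner \<Omega> (\<lambda>x. u m x - \<phi> x) (\<lambda>x. u m x - \<phi> x)) \<longlonglongrightarrow> A * 0"
      using conv unfolding L.conv_def by (intro tendsto_intros)
    then have "(\<lambda>m. A * L2_inner \<Omega> (\<lambda>x. u m x - \<phi> x) (\<lambda>x. u m x - \<phi> x)) \<longlonglongrightarrow> 0" by simp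
    then show "(\<lambda>m. L2_inner \<Omega> (?Y m) (?Y m)) \<longlonglongrightarrow> 0"
      by (rule Lim_null_comparison[rotated]) (simp add: Y L.B_nonneg)
  qed
  have zero: "(\<lambda>x. 0) \<in> L2 \<Omega>" by (simp add: L2_def)
  have "L.conv (\<lambda>m x. 1 * ?X m x + 1 * ?Y m x) (\<lambda>x. 1 * 0 + 1 * 0)"
    by (rule L.conv_lincomb[OF X(1) zero Y(1) zero]) (use lim0 in \<open>simp_all add: L.conv_def\<close>)
  moreover have "1 * ?X m x + 1 * ?Y m x - (1 * 0 + 1 * 0) = p m x * u m x - w x * \<phi> x" for m x
    by (simp add: algebra_simps)
  ultimately show ?thesis unfolding L.conv_def by simp
qed

lemma nu_upper:
  assumes "min \<delta> \<delta>' \<le> t" "t \<le> max \<delta> \<delta>'"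
  shows "(1 - t / 2)\<^sup>2 \<le> nu \<delta> \<delta>'"
proof -
  have "bdd_above ((\<lambda>t. \<bar>1 - t / 2\<bar>\<^sup>2) ` {min \<delta> \<delta>'..max \<delta> \<delta>'})"
    by (intro bounded_imp_bdd_above compact_imp_bounded compact_continuous_image continuous_intros) auto
  from cSUP_upper[OF _ this, of t] assms show ?thesis by (simp add: nu_def)
qed

lemma nu_nonneg: "0 \<le> nu \<delta> \<delta>'"
  by (rule order_trans[OF zero_le_power2 nu_upper[of _ _ \<delta>]]) auto

section \<open>Weights that are functions of the boundary distance\<close>

context degenerate_form
begin

interpretation L: semi_inner "L2 \<Omega>" "L2_inner \<Omega>" by (rule semi_inner_L2)

abbreviation \<nu> :: real where "\<nu> \<equiv> nu \<delta> \<delta>'"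

text \<open>This is s^2/c(s), the \<chi>^(-2) of the overview as a function of the distance, written
  with powers so that the smoothness and derivative rules apply.\<close>

definition rho :: "real \<Rightarrow> real" where
  "rho s = s powr (2 - \<delta>) * (1 + s) powr (\<delta> - \<delta>')"

lemma coef_rho:
  assumes "s > 0" shows "coef \<delta> \<delta>' s * rho s = s\<^sup>2"
proof -
  have "coef \<delta> \<delta>' s * rho s = (s powr \<delta> * s powr (2 - \<delta>)) * ((1 + s) powr (\<delta>' - \<delta>) * (1 + s) powr (\<delta> - \<delta>'))"
    by (simp add: coef_def rho_def mult_ac)
  also have "\<dots> = s powr 2 * (1 + s) powr 0"
    unfolding powr_add[symmetric] by simp
  also have "\<dots> = s\<^sup>2" using assms by simp
  finally show ?thesis .
qed

lemma rho_pos: "s > 0 \<Longrightarrow> rho s > 0"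
  by (simp add: rho_def)

lemma inverse_rho: "s > 0 \<Longrightarrow> inverse (rho s) = coef \<delta> \<delta>' s / s\<^sup>2"
  using coef_rho[of s] coef_pos[of s] rho_pos[of s] by (simp add: field_simps)

text \<open>The derivative of \<open>rho\<close> in logarithmic form: the inner bracket is a convex
  combination of \<delta> and \<delta>' with weight s/(1 + s).\<close>

definition drho :: "real \<Rightarrow> real" where
  "drho s = rho s / s * (2 - (\<delta> + (\<delta>' - \<delta>) * s / (1 + s)))"

lemma rho_deriv:
  assumes "s > 0" shows "(rho has_real_derivative drho s) (at s)"
proof -
  have "(rho has_real_derivative (2 - \<delta>) * s powr (2 - \<delta> - 1) * (1 + s) powr (\<delta> - \<delta>')
      + ((\<delta> - \<delta>') * (1 + s) powr (\<delta> - \<delta>' - 1)) * s powr (2 - \<delta>)) (at s)"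
    unfolding rho_def[abs_def]
    using assms by (auto intro!: derivative_eq_intros)
  moreover have "(2 - \<delta>) * s powr (2 - \<delta> - 1) * (1 + s) powr (\<delta> - \<delta>')
      + ((\<delta> - \<delta>') * (1 + s) powr (\<delta> - \<delta>' - 1)) * s powr (2 - \<delta>) = drho s"
  proof -
    have "s powr (2 - \<delta> - 1) = s powr (2 - \<delta>) / s"
      "(1 + s) powr (\<delta> - \<delta>' - 1) = (1 + s) powr (\<delta> - \<delta>') / (1 + s)"
      using assms by (simp_all only: powr_diff) simp_all
    moreover have "(2 - \<delta>) * (a / s) * b + ((\<delta> - \<delta>') * (b / (1 + s))) * a
        = a * b / s * (2 - (\<delta> + (\<delta>' - \<delta>) * s / (1 + s)))" for a b
    proof -
      have "1 + s \<noteq> 0" using assms by simp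
      then show ?thesis using assms by (simp add: divide_simps) (simp add: algebra_simps)
    qed
    ultimately show ?thesis unfolding drho_def rho_def by simp
  qed
  ultimately show ?thesis by simp
qed

text \<open>Here \<nu> enters. With t the inner bracket of \<open>drho\<close>, the left side is (c
  rho / s^2) rho (2 - t)^2, where c rho = s^2 and (2 - t)^2 is four times a member of the family
  whose supremum is \<nu>.\<close>

lemma coef_drho:
  assumes s: "s > 0"
  shows "coef \<delta> \<delta>' s * (drho s)\<^sup>2 \<le> 4 * \<nu> * rho s"
proof -
  define t where "t = \<delta> + (\<delta>' - \<delta>) * s / (1 + s)"
  define \<theta> where "\<theta> = s / (1 + s)"
  have th: "0 \<le> \<theta>" "\<theta> \<le> 1" using s by (auto simp: \<theta>_def)
  have t: "t = \<delta> + (\<delta>' - \<delta>) * \<theta>" by (simp add: t_def \<theta>_def)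
  have "(1 - t / 2)\<^sup>2 \<le> \<nu>"
  proof (rule nu_upper)
    show "min \<delta> \<delta>' \<le> t" "t \<le> max \<delta> \<delta>'"
      using th mult_left_mono[OF th(2), of "\<delta>' - \<delta>"] mult_left_mono[OF th(2), of "\<delta> - \<delta>'"]
        mult_nonneg_nonneg[of "\<delta>' - \<delta>" \<theta>] mult_nonneg_nonneg[of "\<delta> - \<delta>'" \<theta>]
      unfolding t by (auto simp: min_def max_def algebra_simps)
  qed
  have "coef \<delta> \<delta>' s * (drho s)\<^sup>2 = (coef \<delta> \<delta>' s * rho s) / s\<^sup>2 * rho s * (4 * (1 - t / 2)\<^sup>2)"
  proof -
    have "4 * (1 - t / 2)\<^sup>2 = (2 - t)\<^sup>2" by (simp add: power2_eq_square field_simps)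
    then show ?thesis
      unfolding drho_def t_def[symmetric]
      by (simp add: power_mult_distrib power_divide power2_eq_square[of "rho s"])
  qed
  also have "\<dots> = rho s * (4 * (1 - t / 2)\<^sup>2)" using s by (simp add: coef_rho)
  also have "\<dots> \<le> rho s * (4 * \<nu>)"
    using \<open>(1 - t / 2)\<^sup>2 \<le> \<nu>\<close> rho_pos[OF s] by (intro mult_left_mono) auto
  finally show ?thesis by (simp add: mult_ac)
qed

text \<open>A bounded truncation of \<open>s \<mapsto> sqrt (coef \<delta> \<delta>' s) / s\<close>, which is the case \<open>e = 0\<close>.\<close>

definition trunc :: "real \<Rightarrow> real \<Rightarrow> real" where
  "trunc e s = (rho s + e) powr (-1/2)"

definition dtrunc :: "real \<Rightarrow> real \<Rightarrow> real" where
  "dtrunc e s = -1/2 * (rho s + e) powr (-3/2) * drho s"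

lemma trunc_square:
  assumes "s > 0" "e > 0" shows "(trunc e s)\<^sup>2 = inverse (rho s + e)"
proof -
  have "(trunc e s)\<^sup>2 = (rho s + e) powr (real 2 * (-1/2))"
    unfolding trunc_def by (rule powr_power) (use rho_pos[OF \<open>s > 0\<close>] \<open>e > 0\<close> in simp)
  also have "real 2 * (-1/2) = -1" by simp
  finally show ?thesis using rho_pos[OF \<open>s > 0\<close>] \<open>e > 0\<close> by (simp add: powr_minus)
qed

lemma trunc_deriv:
  assumes "s > 0" "e > 0" shows "(trunc e has_real_derivative dtrunc e s) (at s)"
proof -
  have "rho s + e > 0" using assms rho_pos[of s] by simp
  then show ?thesis
    unfolding trunc_def[abs_def] dtrunc_def
    by (auto intro!: derivative_eq_intros rho_deriv assms)
qed

text \<open>With R = rho + e, the chain rule gives c rho'^2 / (4 R^3), at most \<nu> rho / R^3 by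
  \<open>coef_drho\<close>. Since rho is at most R, truncation costs nothing in the
  constant.\<close>

lemma coef_dtrunc:
  assumes s: "s > 0" and e: "e > 0"
  shows "coef \<delta> \<delta>' s * (dtrunc e s)\<^sup>2 \<le> \<nu> * (trunc e s) ^ 4"
proof -
  define R where "R = rho s + e"
  have R: "R > 0" "rho s \<le> R" using rho_pos[OF s] e by (auto simp: R_def)
  have "(R powr (-3/2))\<^sup>2 = inverse (R ^ 3)"
  proof -
    have "(R powr (-3/2))\<^sup>2 = R powr (real 2 * (-3/2))" by (rule powr_power) (use R in simp)
    also have "real 2 * (-3/2) = -3" by simp
    finally show ?thesis using R by (simp add: powr_minus)
  qed
  then have "coef \<delta> \<delta>' s * (dtrunc e s)\<^sup>2 = (coef \<delta> \<delta>' s * (drho s)\<^sup>2) * (inverse (R ^ 3) / 4)"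
    unfolding dtrunc_def R_def[symmetric] power_mult_distrib by (simp add: power2_eq_square)
  also have "\<dots> \<le> (4 * \<nu> * rho s) * (inverse (R ^ 3) / 4)"
    using coef_drho[OF s] R by (intro mult_right_mono) auto
  also have "\<dots> \<le> (4 * \<nu> * R) * (inverse (R ^ 3) / 4)"
    using R nu_nonneg by (intro mult_right_mono mult_left_mono) auto
  also have "\<dots> = \<nu> * (inverse R)\<^sup>2" using R by (simp add: power2_eq_square power3_eq_cube field_simps)
  also have "(inverse R)\<^sup>2 = trunc e s ^ 4"
    unfolding R_def trunc_square[OF s e, symmetric] by (simp add: power_mult[symmetric])
  finally show ?thesis .
qed

lemma continuous_on_trunc: "e > 0 \<Longrightarrow> continuous_on {0<..} (trunc e)"
  using trunc_deriv by (intro DERIV_continuous_on[of _ _ "dtrunc e"]) (auto intro: DERIV_subset)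

lemma continuous_on_dtrunc: "e > 0 \<Longrightarrow> continuous_on {0<..} (dtrunc e)"
  unfolding dtrunc_def drho_def rho_def
  by (intro continuous_intros) (auto simp: add_pos_pos add_nonneg_eq_0_iff less_imp_neq[THEN not_sym])

lemma cont_diff_trunc:
  assumes S: "\<And>n. cont_diff_on n \<Omega> S" "\<And>x. x \<in> \<Omega> \<Longrightarrow> S x > 0" and e: "e > 0"
  shows "cont_diff_on n \<Omega> (\<lambda>x. trunc e (S x))"
proof -
  have "cont_diff_on n \<Omega> (\<lambda>x. rho (S x))"
    unfolding rho_def
    by (intro cont_diff_on_mult cont_diff_on_powr cont_diff_on_add cont_diff_on_const S(1) open_domain)
      (use S(2) in \<open>auto simp: add_pos_pos\<close>)
  then show ?thesis
    unfolding trunc_def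
    by (intro cont_diff_on_powr cont_diff_on_add cont_diff_on_const open_domain)
      (use S(2) e rho_pos in \<open>auto intro: add_pos_pos\<close>)
qed

lemma trunc_square_le: "s > 0 \<Longrightarrow> e > 0 \<Longrightarrow> (trunc e s)\<^sup>2 \<le> inverse e"
  using rho_pos[of s] by (simp add: trunc_square le_imp_inverse_le)

text \<open>Only the argument of \<open>trunc\<close> is smoothed, while \<open>c\<close> stays
  evaluated at the true distance. As \<open>S\<close> has gradient at most 1, the gradient of the
  composite is controlled by \<open>dtrunc e (S x)\<close>, which is then compared with its value at
  the true distance, where \<open>coef_dtrunc\<close> applies.\<close>

lemma smooth_trunc:
  assumes u: "u \<in> T" and e: "e > 0" and \<epsilon>: "\<epsilon> > 0"
  shows "\<exists>p. (\<forall>n. cont_diff_on n \<Omega> p) \<and> (\<forall>x\<in>\<Omega>. (p x)\<^sup>2 \<le> inverse e) \<and>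
    (\<forall>x\<in>\<Omega>. u x \<noteq> 0 \<longrightarrow> \<bar>p x - trunc e (d x)\<bar> \<le> \<epsilon> \<and>
      c x * grad_inner p p x \<le> \<nu> * trunc e (d x) ^ 4 + \<epsilon>)"
proof -
  obtain K where K: "compact K" "K \<subseteq> \<Omega>" and Ku: "\<And>x. x \<notin> K \<Longrightarrow> u x = 0"
    using test_support[OF u] by blast
  have "bounded (c ` K)"
    by (intro compact_imp_bounded compact_continuous_image K continuous_on_subset[OF continuous_on_c])
  then obtain C where C: "C > 0" "\<And>x. x \<in> K \<Longrightarrow> \<bar>c x\<bar> \<le> C"
    by (auto simp: bounded_pos)
  \<comment> \<open>One \<open>S\<close> must control the weight and its squared derivative
    together; the tolerance involves \<open>C\<close> because the latter gets multiplied by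
    \<open>c\<close>.\<close>
  define G where "G s = (trunc e s, (dtrunc e s)\<^sup>2)" for s
  have "continuous_on {0<..} G"
    unfolding G_def by (intro continuous_intros continuous_on_trunc continuous_on_dtrunc e)
  moreover have "min \<epsilon> (\<epsilon> / C) > 0" using \<epsilon> C by simp
  ultimately obtain S where S: "\<And>n. cont_diff_on n \<Omega> S" "\<And>x. x \<in> \<Omega> \<Longrightarrow> S x > 0"
    "\<And>x. x \<in> \<Omega> \<Longrightarrow> grad_inner S S x \<le> 1"
    and near: "\<And>x. x \<in> K \<Longrightarrow> dist (G (S x)) (G (d x)) < min \<epsilon> (\<epsilon> / C)"
    using smooth_substitute[OF K] by blast
  let ?p = "\<lambda>x. trunc e (S x)"
  have "\<bar>?p x - trunc e (d x)\<bar> \<le> \<epsilon> \<and> c x * grad_inner ?p ?p x \<le> \<nu> * trunc e (d x) ^ 4 + \<epsilon>"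
    if x: "x \<in> \<Omega>" "u x \<noteq> 0" for x
  proof
    have xK: "x \<in> K" using Ku x by blast
    show "\<bar>?p x - trunc e (d x)\<bar> \<le> \<epsilon>"
      using near[OF xK] dist_fst_le[of "G (S x)" "G (d x)"] by (simp add: G_def dist_real_def)
    have nd: "\<bar>(dtrunc e (S x))\<^sup>2 - (dtrunc e (d x))\<^sup>2\<bar> \<le> \<epsilon> / C"
      using near[OF xK] dist_snd_le[of "G (S x)" "G (d x)"] by (simp add: G_def dist_real_def)
    have "S differentiable (at x)" using S(1)[of "Suc 0"] x by simp
    then have "partial k ?p x = dtrunc e (S x) * partial k S x" for k
      by (intro partial_chain trunc_deriv S x e)
    then have "grad_inner ?p ?p x = (dtrunc e (S x))\<^sup>2 * grad_inner S S x"
      by (simp add: grad_inner_def sum_distrib_left power2_eq_square mult_ac)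
    also have "\<dots> \<le> (dtrunc e (S x))\<^sup>2 * 1" using S(3)[OF x(1)] by (intro mult_left_mono) auto
    finally have "c x * grad_inner ?p ?p x \<le> c x * (dtrunc e (S x))\<^sup>2"
      using c_pos[OF x(1)] by (intro mult_left_mono) auto
    also have "\<dots> = c x * (dtrunc e (d x))\<^sup>2 + c x * ((dtrunc e (S x))\<^sup>2 - (dtrunc e (d x))\<^sup>2)"
      by (simp add: algebra_simps)
    also have "\<dots> \<le> \<nu> * trunc e (d x) ^ 4 + C * (\<epsilon> / C)"
    proof (rule add_mono)
      show "c x * (dtrunc e (d x))\<^sup>2 \<le> \<nu> * trunc e (d x) ^ 4"
        unfolding c_eq by (rule coef_dtrunc[OF d_pos[OF x(1)] e])
      have "c x * ((dtrunc e (S x))\<^sup>2 - (dtrunc e (d x))\<^sup>2) \<le> \<bar>c x\<bar> * \<bar>(dtrunc e (S x))\<^sup>2 - (dtrunc e (d x))\<^sup>2\<bar>"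
        unfolding abs_mult[symmetric] by (rule abs_ge_self)
      also have "\<dots> \<le> C * (\<epsilon> / C)"
        using C(2)[OF xK] nd by (intro mult_mono) auto
      finally show "c x * ((dtrunc e (S x))\<^sup>2 - (dtrunc e (d x))\<^sup>2) \<le> C * (\<epsilon> / C)" .
    qed
    also have "C * (\<epsilon> / C) = \<epsilon>" using C by simp
    finally show "c x * grad_inner ?p ?p x \<le> \<nu> * trunc e (d x) ^ 4 + \<epsilon>" .
  qed
  then show ?thesis
    using cont_diff_trunc[OF S(1,2) e] trunc_square_le[OF S(2) e] by (intro exI[of _ ?p]) blast
qed

section \<open>Energies of test functions multiplied by smooth weights\<close>

lemma continuous_on_grad_inner_smooth:
  assumes "\<And>n. cont_diff_on n \<Omega> p" shows "continuous_on \<Omega> (grad_inner p p)"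
  unfolding grad_inner_def
  using assms[of "Suc 0"] by (auto intro!: continuous_intros)

lemma integrable_continuous_test_square:
  assumes f: "f \<in> T" and w: "continuous_on \<Omega> w"
  shows "integrable (lebesgue_on \<Omega>) (\<lambda>x. w x * (f x)\<^sup>2)"
proof -
  obtain K where K: "compact K" "K \<subseteq> \<Omega>" "\<And>x. x \<notin> K \<Longrightarrow> f x = 0"
    using test_support[OF f] by blast
  show ?thesis
    by (rule integrable_compact_support[OF open_domain K(1,2)])
      (use K w test_continuous[OF f] in \<open>auto intro!: continuous_intros\<close>)
qed

lemma energy_mult:
  assumes f: "f \<in> T" and p: "\<And>n. cont_diff_on n \<Omega> p"
  shows "energy (\<lambda>x. p x * f x) (\<lambda>x. p x * f x) = energy f (\<lambda>x. p x * (p x * f x))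
    + (LINT x|lebesgue_on \<Omega>. c x * grad_inner p p x * (f x)\<^sup>2)"
proof -
  have pf: "(\<lambda>x. p x * f x) \<in> T" by (rule test_smooth_mult[OF open_domain f p])
  have ppf: "(\<lambda>x. p x * (p x * f x)) \<in> T" by (rule test_smooth_mult[OF open_domain pf p])
  have pd: "p differentiable (at x)" if "x \<in> \<Omega>" for x using p[of "Suc 0"] that by simp
  have i: "integrable (lebesgue_on \<Omega>) (\<lambda>x. c x * grad_inner p p x * (f x)\<^sup>2)"
    by (intro integrable_continuous_test_square f continuous_intros continuous_on_c
        continuous_on_grad_inner_smooth p)
  have "energy (\<lambda>x. p x * f x) (\<lambda>x. p x * f x)
      = (LINT x|lebesgue_on \<Omega>. c x * grad_inner f (\<lambda>x. p x * (p x * f x)) x + c x * grad_inner p p x * (f x)\<^sup>2)"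
    unfolding energy_def
  proof (intro Bochner_Integration.integral_cong refl)
    fix x assume "x \<in> space (lebesgue_on \<Omega>)"
    then have "p differentiable (at x)" using pd by simp
    from grad_inner_mult[OF test_differentiable[OF f] this]
    show "c x * grad_inner (\<lambda>x. p x * f x) (\<lambda>x. p x * f x) x
        = c x * grad_inner f (\<lambda>x. p x * (p x * f x)) x + c x * grad_inner p p x * (f x)\<^sup>2"
      by (simp only: distrib_left mult_ac)
  qed
  also have "\<dots> = energy f (\<lambda>x. p x * (p x * f x)) + (LINT x|lebesgue_on \<Omega>. c x * grad_inner p p x * (f x)\<^sup>2)"
    unfolding energy_def
    by (rule Bochner_Integration.integral_add[OF integrable_energy[OF continuous_on_c f ppf] i])
  finally show ?thesis .
qed

text \<open>A crude estimate from (a + b)^2 at most 2 a^2 + 2 b^2. It only supplies energy bounds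
  for the weak limits; the sharp constant comes from \<open>energy_mult\<close>.\<close>

lemma energy_mult_le:
  assumes f: "f \<in> T" and p: "\<And>n. cont_diff_on n \<Omega> p" and A: "\<And>x. x \<in> \<Omega> \<Longrightarrow> (p x)\<^sup>2 \<le> A"
    and C: "\<And>x. x \<in> \<Omega> \<Longrightarrow> f x \<noteq> 0 \<Longrightarrow> c x * grad_inner p p x \<le> C"
  shows "energy (\<lambda>x. p x * f x) (\<lambda>x. p x * f x) \<le> 2 * A * energy f f + 2 * C * L2_inner \<Omega> f f"
proof -
  have pf: "(\<lambda>x. p x * f x) \<in> T" by (rule test_smooth_mult[OF open_domain f p])
  have i1: "integrable (lebesgue_on \<Omega>) (\<lambda>x. 2 * A * (c x * grad_inner f f x))"
    using integrable_energy[OF continuous_on_c f f] by simp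
  have i2: "integrable (lebesgue_on \<Omega>) (\<lambda>x. 2 * C * (f x)\<^sup>2)"
    using T_L2[OF f] by (simp add: L2_def)
  have "energy (\<lambda>x. p x * f x) (\<lambda>x. p x * f x)
      \<le> (LINT x|lebesgue_on \<Omega>. 2 * A * (c x * grad_inner f f x) + 2 * C * (f x)\<^sup>2)"
    unfolding energy_def
  proof (rule integral_mono)
    fix x assume "x \<in> space (lebesgue_on \<Omega>)"
    then have x: "x \<in> \<Omega>" by simp
    have "p differentiable (at x)" using p[of "Suc 0"] x by simp
    then have "grad_inner (\<lambda>x. p x * f x) (\<lambda>x. p x * f x) x
        = (\<Sum>k\<in>Basis. (p x * partial k f x + partial k p x * f x)\<^sup>2)"
      unfolding grad_inner_def using test_differentiable[OF f]
      by (simp add: partial_mult power2_eq_square)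
    also have "\<dots> \<le> (\<Sum>k\<in>Basis. 2 * (p x)\<^sup>2 * (partial k f x * partial k f x)
        + 2 * (f x)\<^sup>2 * (partial k p x * partial k p x))"
    proof (rule sum_mono)
      fix k
      show "(p x * partial k f x + partial k p x * f x)\<^sup>2 \<le> 2 * (p x)\<^sup>2 * (partial k f x * partial k f x)
        + 2 * (f x)\<^sup>2 * (partial k p x * partial k p x)"
        using zero_le_power2[of "p x * partial k f x - partial k p x * f x"]
        by (simp add: power2_eq_square algebra_simps)
    qed
    also have "\<dots> = 2 * (p x)\<^sup>2 * grad_inner f f x + 2 * (f x)\<^sup>2 * grad_inner p p x"
      by (simp add: grad_inner_def sum_distrib_left sum.distrib)
    finally have "c x * grad_inner (\<lambda>x. p x * f x) (\<lambda>x. p x * f x) x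
        \<le> c x * (2 * (p x)\<^sup>2 * grad_inner f f x + 2 * (f x)\<^sup>2 * grad_inner p p x)"
      using c_pos[OF x] by (intro mult_left_mono) auto
    also have "\<dots> = 2 * ((p x)\<^sup>2 * (c x * grad_inner f f x)) + 2 * ((c x * grad_inner p p x) * (f x)\<^sup>2)"
      by (simp add: algebra_simps)
    also have "\<dots> \<le> 2 * (A * (c x * grad_inner f f x)) + 2 * (C * (f x)\<^sup>2)"
    proof (intro add_mono mult_left_mono)
      show "(p x)\<^sup>2 * (c x * grad_inner f f x) \<le> A * (c x * grad_inner f f x)"
        using A[OF x] c_pos[OF x] grad_inner_self_nonneg[of f x] by (intro mult_right_mono) auto
      show "c x * grad_inner p p x * (f x)\<^sup>2 \<le> C * (f x)\<^sup>2"
        using C[OF x] by (cases "f x = 0") (auto intro: mult_right_mono)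
    qed auto
    finally show "c x * grad_inner (\<lambda>x. p x * f x) (\<lambda>x. p x * f x) x
        \<le> 2 * A * (c x * grad_inner f f x) + 2 * C * (f x)\<^sup>2" by (simp add: mult.assoc)
  qed (use i1 i2 integrable_energy[OF continuous_on_c pf pf] in auto)
  also have "\<dots> = 2 * A * energy f f + 2 * C * L2_inner \<Omega> f f"
    using i1 i2 by (simp add: energy_def L2_inner_self)
  finally show ?thesis .
qed

section \<open>From test functions to the operator domain\<close>

lemma measurable_continuous: "continuous_on \<Omega> w \<Longrightarrow> w \<in> borel_measurable (lebesgue_on \<Omega>)"
  using open_domain by (intro continuous_imp_measurable_on_sets_lebesgue) auto

lemma continuous_on_trunc_d: "e > 0 \<Longrightarrow> continuous_on \<Omega> (\<lambda>x. trunc e (d x))"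
  by (rule continuous_on_compose2[OF continuous_on_trunc continuous_on_bdist]) (auto simp: d_pos)

text \<open>On test functions this is the identity
  \<open>h(p u) = h(u, p\<^sup>2 u) + \<integral> c \<bar>\<nabla>p\<bar>\<^sup>2 u\<^sup>2\<close>. In the limit the left side is only lower semicontinuous,
  because the gradients of the smooth replacements of \<open>trunc e (d x)\<close> need not converge.\<close>

lemma h_form_trunc_le:
  assumes op: "(\<phi>, \<psi>) \<in> H_op \<delta> \<delta>' \<Omega>" and e: "e > 0"
  shows "(\<lambda>x. trunc e (d x) * \<phi> x) \<in> h_dom \<delta> \<delta>' \<Omega>" (is ?A)
    and "h_form \<delta> \<delta>' \<Omega> (\<lambda>x. trunc e (d x) * \<phi> x)
      \<le> L2_inner \<Omega> \<psi> (\<lambda>x. trunc e (d x) * (trunc e (d x) * \<phi> x))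
        + \<nu> * L2_inner \<Omega> (\<lambda>x. trunc e (d x) * (trunc e (d x) * \<phi> x))
            (\<lambda>x. trunc e (d x) * (trunc e (d x) * \<phi> x))" (is ?B)
proof -
  define g where "g x = trunc e (d x)" for x
  define A where "A = inverse e"
  define \<epsilon> where "\<epsilon> m = inverse (real (Suc m))" for m
  have \<epsilon>: "\<epsilon> m > 0" "\<epsilon> m \<le> 1" for m by (auto simp: \<epsilon>_def inverse_le_1_iff)
  have \<epsilon>0: "\<epsilon> \<longlonglongrightarrow> 0" unfolding \<epsilon>_def by (rule LIMSEQ_inverse_real_of_nat)
  have A: "A > 0" using e by (simp add: A_def)
  from op have phi_dom: "\<phi> \<in> h_dom \<delta> \<delta>' \<Omega>"
    and weak: "\<And>\<eta>. \<eta> \<in> h_dom \<delta> \<delta>' \<Omega> \<Longrightarrow> polarization (h_form \<delta> \<delta>' \<Omega>) \<phi> \<eta> = L2_inner \<Omega> \<psi> \<eta>"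
    by (auto simp: H_op_def form_operator_def)
  from phi_dom obtain u where u: "form_approx \<Omega> T (pre_form \<delta> \<delta>' \<Omega>) \<phi> u" and phi: "\<phi> \<in> L2 \<Omega>"
    by (auto simp: h_dom_def closure_dom_def)
  have uT: "u m \<in> T" for m by (rule E.approx_mem[OF u])
  note uL = T_L2[OF uT]
  have u_conv: "L.conv u \<phi>" by (rule E.approx_conv[OF u])
  have g_meas: "g \<in> borel_measurable (lebesgue_on \<Omega>)"
    unfolding g_def by (intro measurable_continuous continuous_on_trunc_d e)
  have gA: "(g x)\<^sup>2 \<le> A" if "x \<in> \<Omega>" for x
    unfolding g_def A_def by (rule trunc_square_le[OF d_pos[OF that] e])
  note gmult = L2_bounded_mult[of _ \<Omega> g A, OF _ g_meas gA]
  \<comment> \<open>A separate weight is chosen for each \<open>u m\<close>, because the supports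
    may exhaust \<Omega>; the tolerance tends to zero.\<close>
  define Q where "Q m p \<longleftrightarrow> (\<forall>n. cont_diff_on n \<Omega> p) \<and> (\<forall>x\<in>\<Omega>. (p x)\<^sup>2 \<le> inverse e) \<and>
    (\<forall>x\<in>\<Omega>. u m x \<noteq> 0 \<longrightarrow> \<bar>p x - trunc e (d x)\<bar> \<le> \<epsilon> m \<and>
      c x * grad_inner p p x \<le> \<nu> * trunc e (d x) ^ 4 + \<epsilon> m)" for m p
  have "\<forall>m. \<exists>p. Q m p" unfolding Q_def by (intro allI smooth_trunc uT e \<epsilon>)
  then obtain p where "\<And>m. Q m (p m)" using choice[of Q] by blast
  then have p: "\<And>m n. cont_diff_on n \<Omega> (p m)" and pA: "\<And>m x. x \<in> \<Omega> \<Longrightarrow> (p m x)\<^sup>2 \<le> A"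
    and near: "\<And>m x. x \<in> \<Omega> \<Longrightarrow> u m x \<noteq> 0 \<Longrightarrow> \<bar>p m x - g x\<bar> \<le> \<epsilon> m"
    and grad: "\<And>m x. x \<in> \<Omega> \<Longrightarrow> u m x \<noteq> 0 \<Longrightarrow> c x * grad_inner (p m) (p m) x \<le> \<nu> * g x ^ 4 + \<epsilon> m"
    unfolding Q_def A_def g_def by blast+
  define v where "v m = (\<lambda>x. p m x * u m x)" for m
  define \<eta> where "\<eta> m = (\<lambda>x. p m x * v m x)" for m
  have vT: "v m \<in> T" for m unfolding v_def by (rule test_smooth_mult[OF open_domain uT p])
  have \<eta>T: "\<eta> m \<in> T" for m unfolding \<eta>_def by (rule test_smooth_mult[OF open_domain vT p])
  note vL = T_L2[OF vT] and \<eta>L = T_L2[OF \<eta>T]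
  have p_meas: "p m \<in> borel_measurable (lebesgue_on \<Omega>)" for m
    by (intro measurable_continuous cont_diff_imp_continuous p)
  have v_conv: "L.conv v (\<lambda>x. g x * \<phi> x)"
    unfolding v_def by (rule L2_conv_mult[OF uL phi u_conv p_meas g_meas near \<epsilon>0 gA])
  have \<eta>_conv: "L.conv \<eta> (\<lambda>x. g x * (g x * \<phi> x))"
    unfolding \<eta>_def
    by (rule L2_conv_mult[OF vL gmult(1)[OF phi] v_conv p_meas g_meas _ \<epsilon>0 gA])
      (auto simp: v_def intro: near)
  define C where "C = \<nu> * A\<^sup>2 + 1"
  have grad_C: "c x * grad_inner (p m) (p m) x \<le> C" if "x \<in> \<Omega>" "u m x \<noteq> 0" for m x
  proof -
    have "g x ^ 4 = (g x)\<^sup>2 * (g x)\<^sup>2" by (simp add: power_add[symmetric])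
    also have "\<dots> \<le> A * A" using gA[OF that(1)] A by (intro mult_mono) auto
    finally have "\<nu> * g x ^ 4 \<le> \<nu> * A\<^sup>2"
      using nu_nonneg by (intro mult_left_mono) (auto simp: power2_eq_square)
    then show ?thesis using grad[OF that] \<epsilon>(2)[of m] by (simp add: C_def)
  qed
  have C: "C \<ge> 0" using nu_nonneg[of \<delta> \<delta>'] by (simp add: C_def add_nonneg_nonneg)
  obtain M1 where M1: "M1 \<ge> 0" "\<And>m. E.nrm (u m) \<le> M1" using E.approx_bounded[OF u] by blast
  have EM1: "energy (u m) (u m) \<le> M1\<^sup>2" for m
    using power_mono[OF M1(2) E.nrm_nonneg[OF uT], of m 2] by (simp add: E.nrm_square uT)
  have "convergent (\<lambda>m. L2_inner \<Omega> (u m) (u m))"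
    using L.conv_B[OF uL phi uL phi u_conv u_conv] by (auto simp: convergent_def)
  then obtain M2 where M2: "\<And>m. L2_inner \<Omega> (u m) (u m) \<le> M2"
    using convergent_imp_Bseq[of "\<lambda>m. L2_inner \<Omega> (u m) (u m)"] by (auto simp: Bseq_def abs_le_iff)
  define K where "K = 2 * A * M1\<^sup>2 + 2 * C * M2"
  have vK: "energy (v m) (v m) \<le> K" for m
  proof -
    have "energy (v m) (v m) \<le> 2 * A * energy (u m) (u m) + 2 * C * L2_inner \<Omega> (u m) (u m)"
      unfolding v_def by (rule energy_mult_le[OF uT p pA grad_C])
    also have "\<dots> \<le> K"
      unfolding K_def using EM1 M2 A C by (intro add_mono mult_left_mono) auto
    finally show ?thesis .
  qed
  have \<eta>K: "energy (\<eta> m) (\<eta> m) \<le> 2 * A * K + 2 * C * (A * M2)" for m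
  proof -
    have "L2_inner \<Omega> (v m) (v m) \<le> A * L2_inner \<Omega> (u m) (u m)"
      unfolding v_def by (rule L2_bounded_mult(2)[OF uL p_meas pA])
    also have "\<dots> \<le> A * M2" using M2 A by (intro mult_left_mono) auto
    finally have vM: "L2_inner \<Omega> (v m) (v m) \<le> A * M2" .
    have "energy (\<eta> m) (\<eta> m) \<le> 2 * A * energy (v m) (v m) + 2 * C * L2_inner \<Omega> (v m) (v m)"
      unfolding \<eta>_def by (rule energy_mult_le[OF vT p pA grad_C]) (auto simp: v_def)
    also have "\<dots> \<le> 2 * A * K + 2 * C * (A * M2)"
      using vK vM A C by (intro add_mono mult_left_mono) auto
    finally show ?thesis .
  qed
  have g\<phi>: "(\<lambda>x. g x * \<phi> x) \<in> L2 \<Omega>" "(\<lambda>x. g x * (g x * \<phi> x)) \<in> L2 \<Omega>"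
    using gmult(1)[OF phi] gmult(1)[OF gmult(1)[OF phi]] by simp_all
  \<comment> \<open>Lower semicontinuity with a constant energy bound, used here only for
    membership, so that g^2 \<phi> is admissible in the weak equation for the operator.\<close>
  have gg_dom: "(\<lambda>x. g x * (g x * \<phi> x)) \<in> h_dom \<delta> \<delta>' \<Omega>"
    unfolding h_dom_def
    by (rule E.closure_lower_semicontinuous(1)[OF \<eta>T g\<phi>(2) \<eta>_conv \<eta>K tendsto_const])
  have "E.nrm (\<eta> m) \<le> sqrt (2 * A * K + 2 * C * (A * M2))" for m
    unfolding E.nrm_def using \<eta>K by (rule real_sqrt_le_mono)
  \<comment> \<open>The mixed term pairs the form-Cauchy \<open>u\<close> with the merely bounded
    \<eta>; the weak equation identifies its limit.\<close>
  from E.strong_weak_lim[OF u phi \<eta>T gg_dom[unfolded h_dom_def] \<eta>_conv this]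
  have lim: "(\<lambda>m. energy (u m) (\<eta> m)) \<longlonglongrightarrow> L2_inner \<Omega> \<psi> (\<lambda>x. g x * (g x * \<phi> x))"
    using weak[OF gg_dom] by (simp add: h_form_def)
  define G where "G w = (\<lambda>x. g x * (g x * w x))" for w :: "'a \<Rightarrow> real"
  have GL: "G w \<in> L2 \<Omega>" if "w \<in> L2 \<Omega>" for w unfolding G_def by (intro gmult(1) that)
  have gu_conv: "L.conv (\<lambda>m x. g x * u m x) (\<lambda>x. g x * \<phi> x)"
    by (rule L2_conv_mult[OF uL phi u_conv g_meas g_meas _ \<epsilon>0 gA]) (simp add: less_imp_le[OF \<epsilon>(1)])
  have G_conv: "L.conv (\<lambda>m. G (u m)) (G \<phi>)"
    unfolding G_def
    by (rule L2_conv_mult[OF gmult(1)[OF uL] g\<phi>(1) gu_conv g_meas g_meas _ \<epsilon>0 gA])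
      (simp_all add: less_imp_le[OF \<epsilon>(1)])
  \<comment> \<open>An upper bound for the energy of \<open>v m\<close> in which every term
    converges, so that lower semicontinuity gives the claimed inequality.\<close>
  define b where "b m = energy (u m) (\<eta> m) + (\<nu> * L2_inner \<Omega> (G (u m)) (G (u m)) + \<epsilon> m * L2_inner \<Omega> (u m) (u m))" for m
  have b: "b \<longlonglongrightarrow> L2_inner \<Omega> \<psi> (G \<phi>) + (\<nu> * L2_inner \<Omega> (G \<phi>) (G \<phi>) + 0 * L2_inner \<Omega> \<phi> \<phi>)"
    unfolding b_def
    by (intro tendsto_intros lim[folded G_def] \<epsilon>0 L.conv_B GL uL phi G_conv u_conv)
  have vb: "energy (v m) (v m) \<le> b m" for m
  proof -
    have i1: "integrable (lebesgue_on \<Omega>) (\<lambda>x. c x * grad_inner (p m) (p m) x * (u m x)\<^sup>2)"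
      by (intro integrable_continuous_test_square uT continuous_intros continuous_on_c
          continuous_on_grad_inner_smooth p)
    have i2: "integrable (lebesgue_on \<Omega>) (\<lambda>x. \<nu> * (G (u m) x)\<^sup>2 + \<epsilon> m * (u m x)\<^sup>2)"
      using GL[OF uL] uL by (simp add: L2_def)
    have "(LINT x|lebesgue_on \<Omega>. c x * grad_inner (p m) (p m) x * (u m x)\<^sup>2)
        \<le> (LINT x|lebesgue_on \<Omega>. \<nu> * (G (u m) x)\<^sup>2 + \<epsilon> m * (u m x)\<^sup>2)"
    proof (rule integral_mono[OF i1 i2])
      fix x assume "x \<in> space (lebesgue_on \<Omega>)"
      then have x: "x \<in> \<Omega>" by simp
      have "c x * grad_inner (p m) (p m) x * (u m x)\<^sup>2 \<le> (\<nu> * g x ^ 4 + \<epsilon> m) * (u m x)\<^sup>2"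
        using grad[OF x] by (cases "u m x = 0") (auto intro: mult_right_mono)
      also have "\<dots> = \<nu> * (G (u m) x)\<^sup>2 + \<epsilon> m * (u m x)\<^sup>2"
        by (simp add: G_def power_mult_distrib distrib_right mult.assoc power_add[symmetric]
            flip: mult.assoc[of "(g x)\<^sup>2"])
      finally show "c x * grad_inner (p m) (p m) x * (u m x)\<^sup>2 \<le> \<nu> * (G (u m) x)\<^sup>2 + \<epsilon> m * (u m x)\<^sup>2" .
    qed
    also have "\<dots> = \<nu> * L2_inner \<Omega> (G (u m)) (G (u m)) + \<epsilon> m * L2_inner \<Omega> (u m) (u m)"
      using GL[OF uL, of m] uL[of m] by (simp add: L2_inner_self L2_def)
    finally show ?thesis
      unfolding b_def using energy_mult[OF uT p, of m m] by (simp add: v_def \<eta>_def)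
  qed
  note lsc = E.closure_lower_semicontinuous[OF vT g\<phi>(1) v_conv vb b]
  show ?A using lsc(1) by (simp add: h_dom_def g_def)
  show ?B using lsc(2) by (simp add: h_form_def g_def G_def)
qed

text \<open>Hardy for g \<phi> carries the full weight c/d^2 = 1/rho, which dominates g^2 = 1/(rho +
  e), so the truncation loses in the right direction. Boundedness of \<open>g\<close> makes
  \<open>X\<close> finite, which allows it to be cancelled after Cauchy--Schwarz.\<close>

lemma truncated_rellich:
  assumes op: "(\<phi>, \<psi>) \<in> H_op \<delta> \<delta>' \<Omega>" and e: "e > 0" and a1: "\<nu> < a1"
    and hardy: "\<And>\<phi>. \<phi> \<in> h_dom \<delta> \<delta>' \<Omega> \<Longrightarrow>
      (\<lambda>x. sqrt (c x) / d x * \<phi> x) \<in> L2 \<Omega> \<and>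
      h_form \<delta> \<delta>' \<Omega> \<phi> \<ge> a1 *
        L2_inner \<Omega> (\<lambda>x. sqrt (c x) / d x * \<phi> x) (\<lambda>x. sqrt (c x) / d x * \<phi> x)"
  shows "(\<lambda>x. (trunc e (d x))\<^sup>2 * \<phi> x) \<in> L2 \<Omega>"
    and "(a1 - \<nu>)\<^sup>2 * L2_inner \<Omega> (\<lambda>x. (trunc e (d x))\<^sup>2 * \<phi> x) (\<lambda>x. (trunc e (d x))\<^sup>2 * \<phi> x)
      \<le> L2_inner \<Omega> \<psi> \<psi>"
proof -
  define g where "g x = trunc e (d x)" for x
  have g_meas: "g \<in> borel_measurable (lebesgue_on \<Omega>)"
    unfolding g_def by (intro measurable_continuous continuous_on_trunc_d e)
  have gA: "(g x)\<^sup>2 \<le> inverse e" if "x \<in> \<Omega>" for x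
    unfolding g_def by (rule trunc_square_le[OF d_pos[OF that] e])
  note gmult = L2_bounded_mult[of _ \<Omega> g, OF _ g_meas gA]
  have phi: "\<phi> \<in> L2 \<Omega>" and psi: "\<psi> \<in> L2 \<Omega>"
    using op by (auto simp: H_op_def form_operator_def h_dom_def closure_dom_def)
  define F where "F = (\<lambda>x. g x * (g x * \<phi> x))"
  define W where "W = (\<lambda>x. sqrt (c x) / d x * (g x * \<phi> x))"
  define X where "X = L2_inner \<Omega> F F"
  have FL: "F \<in> L2 \<Omega>" unfolding F_def by (intro gmult(1) phi)
  note dom = h_form_trunc_le[OF op e, folded g_def, folded F_def]
  have WL: "W \<in> L2 \<Omega>" and hW: "a1 * L2_inner \<Omega> W W \<le> h_form \<delta> \<delta>' \<Omega> (\<lambda>x. g x * \<phi> x)"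
    using hardy[OF dom(1)] by (simp_all add: W_def)
  have "X \<le> L2_inner \<Omega> W W"
    unfolding X_def L2_inner_self
  proof (rule integral_mono)
    fix x assume "x \<in> space (lebesgue_on \<Omega>)"
    then have x: "x \<in> \<Omega>" by simp
    have "(g x)\<^sup>2 \<le> inverse (rho (d x))"
      unfolding g_def trunc_square[OF d_pos[OF x] e]
      using rho_pos[OF d_pos[OF x]] e by (intro le_imp_inverse_le) auto
    also have "\<dots> = (sqrt (c x) / d x)\<^sup>2"
      using c_pos[OF x] by (simp add: inverse_rho[OF d_pos[OF x]] c_eq power_divide)
    finally show "(F x)\<^sup>2 \<le> (W x)\<^sup>2"
      unfolding F_def W_def power_mult_distrib by (intro mult_right_mono) auto
  qed (use FL WL in \<open>auto simp: L2_def\<close>)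
  then have "a1 * X \<le> a1 * L2_inner \<Omega> W W"
    using a1 nu_nonneg[of \<delta> \<delta>'] by (intro mult_left_mono) auto
  then have le: "(a1 - \<nu>) * X \<le> L2_inner \<Omega> \<psi> F"
    using hW dom(2) by (simp add: X_def algebra_simps)
  have X0: "X \<ge> 0" unfolding X_def by (rule L.B_nonneg[OF FL])
  have "(a1 - \<nu>)\<^sup>2 * X \<le> L2_inner \<Omega> \<psi> \<psi>"
  \<comment> \<open>For nonzero \<open>X\<close> one factor \<open>X\<close> is divided out of the
    squared inequality.\<close>
  proof (cases "X = 0")
    case False
    have "((a1 - \<nu>) * X)\<^sup>2 \<le> (L2_inner \<Omega> \<psi> F)\<^sup>2"
      using le a1 X0 by (intro power_mono) auto
    also have "\<dots> \<le> L2_inner \<Omega> \<psi> \<psi> * X"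
      unfolding X_def by (rule L.Cauchy_Schwarz[OF psi FL])
    finally have "((a1 - \<nu>)\<^sup>2 * X) * X \<le> L2_inner \<Omega> \<psi> \<psi> * X"
      by (simp add: power2_eq_square mult_ac)
    then show ?thesis using False X0 by (simp add: mult_le_cancel_right)
  qed (simp add: L.B_nonneg psi)
  moreover have "F = (\<lambda>x. (trunc e (d x))\<^sup>2 * \<phi> x)"
    by (auto simp: F_def g_def power2_eq_square mult.assoc)
  ultimately show "(\<lambda>x. (trunc e (d x))\<^sup>2 * \<phi> x) \<in> L2 \<Omega>"
    and "(a1 - \<nu>)\<^sup>2 * L2_inner \<Omega> (\<lambda>x. (trunc e (d x))\<^sup>2 * \<phi> x) (\<lambda>x. (trunc e (d x))\<^sup>2 * \<phi> x)
      \<le> L2_inner \<Omega> \<psi> \<psi>"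
    using FL by (simp_all add: X_def)
qed

text \<open>The truncated bound does not depend on \<open>e\<close>, so monotone convergence along e
  = 1/(n + 1) gives the membership in L2 and the inequality together.\<close>

lemma rellich:
  assumes op: "(\<phi>, \<psi>) \<in> H_op \<delta> \<delta>' \<Omega>" and a1: "\<nu> < a1"
    and hardy: "\<And>\<phi>. \<phi> \<in> h_dom \<delta> \<delta>' \<Omega> \<Longrightarrow>
      (\<lambda>x. sqrt (c x) / d x * \<phi> x) \<in> L2 \<Omega> \<and>
      h_form \<delta> \<delta>' \<Omega> \<phi> \<ge> a1 *
        L2_inner \<Omega> (\<lambda>x. sqrt (c x) / d x * \<phi> x) (\<lambda>x. sqrt (c x) / d x * \<phi> x)"
  shows "(\<lambda>x. c x / (d x)\<^sup>2 * \<phi> x) \<in> L2 \<Omega>"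
    and "(a1 - \<nu>)\<^sup>2 * L2_inner \<Omega> (\<lambda>x. c x / (d x)\<^sup>2 * \<phi> x) (\<lambda>x. c x / (d x)\<^sup>2 * \<phi> x) \<le> L2_inner \<Omega> \<psi> \<psi>"
proof -
  define e where "e n = inverse (real (Suc n))" for n
  have e: "e n > 0" for n by (simp add: e_def)
  have e0: "e \<longlonglongrightarrow> 0" unfolding e_def by (rule LIMSEQ_inverse_real_of_nat)
  define f where "f n x = ((trunc (e n) (d x))\<^sup>2 * \<phi> x)\<^sup>2" for n x
  define F where "F x = c x / (d x)\<^sup>2 * \<phi> x" for x
  note tr = truncated_rellich[OF op e a1 hardy]
  define B where "B = L2_inner \<Omega> \<psi> \<psi> / (a1 - \<nu>)\<^sup>2"
  have f_eq: "f n x = (inverse (rho (d x) + e n) * \<phi> x)\<^sup>2" if "x \<in> \<Omega>" for n x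
    unfolding f_def by (simp add: trunc_square[OF d_pos[OF that] e])
  have fi: "integrable (lebesgue_on \<Omega>) (f n)" for n
    using tr(1)[of n] by (simp add: L2_def f_def[abs_def])
  have fB: "(LINT x|lebesgue_on \<Omega>. f n x) \<le> B" for n
    using tr(2)[of n] a1 by (simp add: B_def f_def L2_inner_self field_simps)
  have mono_f: "f m x \<le> f n x" if "x \<in> \<Omega>" "m \<le> n" for m n x
  proof -
    have "e n \<le> e m" unfolding e_def using that(2) by (intro le_imp_inverse_le) auto
    then have "inverse (rho (d x) + e m) \<le> inverse (rho (d x) + e n)"
      using rho_pos[OF d_pos[OF that(1)]] e[of n] by (intro le_imp_inverse_le) auto
    then have "(inverse (rho (d x) + e m))\<^sup>2 \<le> (inverse (rho (d x) + e n))\<^sup>2"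
      using rho_pos[OF d_pos[OF that(1)]] e[of m] by (intro power_mono) auto
    then show ?thesis
      unfolding f_eq[OF that(1)] power_mult_distrib by (intro mult_right_mono) auto
  qed
  \<comment> \<open>The pointwise limit is the squared full weight, since 1/rho = c/d^2.\<close>
  have f_lim: "(\<lambda>n. f n x) \<longlonglongrightarrow> (F x)\<^sup>2" if "x \<in> \<Omega>" for x
  proof -
    have "(\<lambda>n. (inverse (rho (d x) + e n) * \<phi> x)\<^sup>2) \<longlonglongrightarrow> (inverse (rho (d x) + 0) * \<phi> x)\<^sup>2"
      using rho_pos[OF d_pos[OF that]] by (intro tendsto_intros e0) auto
    then show ?thesis
      using f_eq[OF that] inverse_rho[OF d_pos[OF that]] by (simp add: F_def c_eq)
  qed
  have "incseq (\<lambda>n. LINT x|lebesgue_on \<Omega>. f n x)"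
    by (intro incseq_SucI integral_mono fi) (simp add: mono_f)
  from incseq_convergent[OF this] fB
  obtain l where l: "(\<lambda>n. LINT x|lebesgue_on \<Omega>. f n x) \<longlonglongrightarrow> l" by blast
  have lB: "l \<le> B" by (rule LIMSEQ_le_const2[OF l]) (use fB in blast)
  have Fm: "F \<in> borel_measurable (lebesgue_on \<Omega>)"
  proof -
    have "\<phi> \<in> borel_measurable (lebesgue_on \<Omega>)"
      using op by (auto simp: H_op_def form_operator_def h_dom_def closure_dom_def L2_def)
    moreover have "(\<lambda>x. c x / (d x)\<^sup>2) \<in> borel_measurable (lebesgue_on \<Omega>)"
      by (intro measurable_continuous continuous_intros continuous_on_c continuous_on_bdist)
        (use d_pos in force)
    ultimately show ?thesis unfolding F_def by (rule borel_measurable_times[rotated])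
  qed
  have mono: "AE x in lebesgue_on \<Omega>. mono (\<lambda>n. f n x)"
    by (intro AE_I2) (simp add: mono_def mono_f)
  have lim: "AE x in lebesgue_on \<Omega>. (\<lambda>n. f n x) \<longlonglongrightarrow> (F x)\<^sup>2"
    by (intro AE_I2) (simp add: f_lim)
  have F2m: "(\<lambda>x. (F x)\<^sup>2) \<in> borel_measurable (lebesgue_on \<Omega>)" using Fm by simp
  have FL: "F \<in> L2 \<Omega>"
    using integrable_monotone_convergence[OF fi mono lim l F2m] Fm by (simp add: L2_def)
  have "L2_inner \<Omega> F F = l"
    using integral_monotone_convergence[OF fi mono lim l F2m] by (simp add: L2_inner_self)
  then have "(a1 - \<nu>)\<^sup>2 * L2_inner \<Omega> F F \<le> L2_inner \<Omega> \<psi> \<psi>"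
    using lB a1 by (simp add: B_def field_simps)
  then show "(\<lambda>x. c x / (d x)\<^sup>2 * \<phi> x) \<in> L2 \<Omega>"
    and "(a1 - \<nu>)\<^sup>2 * L2_inner \<Omega> (\<lambda>x. c x / (d x)\<^sup>2 * \<phi> x) (\<lambda>x. c x / (d x)\<^sup>2 * \<phi> x) \<le> L2_inner \<Omega> \<psi> \<psi>"
    using FL by (simp_all add: F_def[abs_def])
qed

end

theorem theorem1p2:
  fixes \<Omega> :: "'a::euclidean_space set" and \<delta> \<delta>' a1 :: real
  assumes "open \<Omega>" and "connected \<Omega>" and "\<Omega> \<noteq> UNIV"
    and "\<delta> \<ge> 0" and "\<delta>' \<ge> 0"
    and "a1 > 0"
    and hardy: "\<And>\<phi>. \<phi> \<in> h_dom \<delta> \<delta>' \<Omega> \<Longrightarrow>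
      (\<lambda>x. sqrt (coef_on \<delta> \<delta>' \<Omega> x) / bdist \<Omega> x * \<phi> x) \<in> L2 \<Omega> \<and>
      h_form \<delta> \<delta>' \<Omega> \<phi> \<ge> a1 *
        L2_inner \<Omega> (\<lambda>x. sqrt (coef_on \<delta> \<delta>' \<Omega> x) / bdist \<Omega> x * \<phi> x)
                   (\<lambda>x. sqrt (coef_on \<delta> \<delta>' \<Omega> x) / bdist \<Omega> x * \<phi> x)"
    and "nu \<delta> \<delta>' < a1"
  shows "\<forall>(\<phi>, H\<phi>) \<in> H_op \<delta> \<delta>' \<Omega>.
      (\<lambda>x. coef_on \<delta> \<delta>' \<Omega> x / (bdist \<Omega> x)\<^sup>2 * \<phi> x) \<in> L2 \<Omega> \<and>
      L2_inner \<Omega> H\<phi> H\<phi> \<ge> (a1 - nu \<delta> \<delta>')\<^sup>2 *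
        L2_inner \<Omega> (\<lambda>x. coef_on \<delta> \<delta>' \<Omega> x / (bdist \<Omega> x)\<^sup>2 * \<phi> x)
                   (\<lambda>x. coef_on \<delta> \<delta>' \<Omega> x / (bdist \<Omega> x)\<^sup>2 * \<phi> x)"
proof -
  interpret degenerate_form \<Omega> \<delta> \<delta>' by unfold_locales fact+
  have "(\<lambda>x. coef_on \<delta> \<delta>' \<Omega> x / (bdist \<Omega> x)\<^sup>2 * \<phi> x) \<in> L2 \<Omega> \<and>
      L2_inner \<Omega> \<psi> \<psi> \<ge> (a1 - nu \<delta> \<delta>')\<^sup>2 *
        L2_inner \<Omega> (\<lambda>x. coef_on \<delta> \<delta>' \<Omega> x / (bdist \<Omega> x)\<^sup>2 * \<phi> x)
                   (\<lambda>x. coef_on \<delta> \<delta>' \<Omega> x / (bdist \<Omega> x)\<^sup>2 * \<phi> x)"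
    if "(\<phi>, \<psi>) \<in> H_op \<delta> \<delta>' \<Omega>" for \<phi> \<psi>
    using rellich[OF that \<open>nu \<delta> \<delta>' < a1\<close> hardy] by blast
  then show ?thesis by blast
qed

end
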